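(* Let $N\ge 1$, $1<p<\infty$, $h>0$. Let $J\in C^1(\mathbb{R}^N)$ be non-negative, even, supported in the ball of center $0$ and radius $1$, with bounded first-order partial derivatives, and suppose there is $0<S<\infty$ such that for each $i=1,\dots,N$, $\sup_{x\in\mathbb{R}^N}\int_{\mathbb{R}^N}|\partial_{x_i}J(x-y)|\,dy\le S$ and $\sup_{y\in\mathbb{R}^N}\int_{\mathbb{R}^N}|\partial_{x_i}J(x-y)|\,dx\le S$. Let $f:\mathbb{R}\to\mathbb{R}$ be non-negative, nondecreasing, globally Lipschitz (there is $k_1>0$ with $|f(x)-f(y)|\le k_1|x-y|$ for all $x,y\in\mathbb{R}$) and bounded: there is $a>0$ with $|f(x)|\le a$ for all $x\in\mathbb{R}$. Let $\rho:\mathbb{R}^N\to\mathbb{R}$ be an integrable positive even function with $\int_{\mathbb{R}^N}\rho(x)\,dx=1$, and let $K>0$ be a constant such that $\sup\{\rho(x): x\in\mathbb{R}^N,\ |x-y|\le 1\}\le K\rho(y)$ for all $y\in\mathbb{R}^N$. Put $R=aK^{1/p}\|J\|_{L^1}+h$, let $\varepsilon>0$, and let $\mathcal{B}(0,R+\varepsilon)$ be the ball of $L^p(\mathbb{R}^N,\rho)$ with center $0$ and radius $R+\varepsilon$. Then $\mathcal{A}=\omega(\mathcal{B}(0,R+\varepsilon))$ is a global attractor in $L^p(\mathbb{R}^N,\rho)$ for the flow $S(t)$ generated by $$\frac{\partial u}{\partial t}(x,t)=-u(x,t)+\int_{\mathbb{R}^N}J(x-y)f(u(y,t))\,dy+h,$$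 and $\mathcal{A}$ is contained in the ball $\{u:\|u\|_{L^p(\mathbb{R}^N,\rho)}\le R\}$.
   Context: $L^p(\mathbb{R}^N,\rho)=\{u\in L^1_{\rm loc}(\mathbb{R}^N):\int_{\mathbb{R}^N}|u(x)|^p\rho(x)\,dx<\infty\}$ with norm $\|u\|_{L^p(\mathbb{R}^N,\rho)}=\left(\int_{\mathbb{R}^N}|u(x)|^p\rho(x)\,dx\right)^{1/p}$. The equation is regarded as an ODE $\dot u=F(u)$, $F(u)=-u+J*(f\circ u)+h$, in the Banach space $L^p(\mathbb{R}^N,\rho)$, where $(J*v)(x)=\int_{\mathbb{R}^N}J(x-y)v(y)\,dy$; $F$ is globally Lipschitz, so for each $u_0\in L^p(\mathbb{R}^N,\rho)$ there is a unique global solution, and $S(t)u_0$ denotes its value at time $t$. For a set $C$, $\omega(C)=\bigcap_{s\ge 0}\overline{\bigcup_{t\ge s}S(t)C}$ (closure in $L^p(\mathbb{R}^N,\rho)$). A global attractor is a compact set $\mathcal{A}$, invariant ($S(t)\mathcal{A}=\mathcal{A}$ for all $t\ge0$) and maximal with this property among bounded sets, which attracts every bounded set $B\subset L^p(\mathbb{R}^N,\rho)$, i.e. $\sup_{b\in B}\inf_{y\in\mathcal{A}}\|S(t)b-y\|_{L^p(\mathbb{R}^N,\rho)}\to0$ as $t\to\infty$. *)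

theory Defs
  imports "HOL-Analysis.Analysis"
begin

text \<open>
  Real functions on a Euclidean space modulo equality Lebesgue-almost everywhere.  No measurability
  is imposed on the type itself: since \<^const>\<open>lebesgue\<close> is complete, measurability is invariant under
  almost-everywhere equality, and it is part of the conditions below that carve out the
  weighted Lebesgue spaces.
\<close>

lemma lebesgue_measurable_cong_AE:
  fixes u v :: "'a::euclidean_space \<Rightarrow> real"
  assumes u: "u \<in> borel_measurable lebesgue" and ae: "AE x in lebesgue. u x = v x"
  shows "v \<in> borel_measurable lebesgue"
proof (rule measurableI)
  fix A :: "real set"
  assume "A \<in> sets borel"
  with u have "u -` A \<inter> space lebesgue \<in> sets lebesgue"
    by (rule measurable_sets)
  moreover have "AE x in lebesgue. x \<in> v -` A \<inter> space lebesgue \<longleftrightarrow> x \<in> u -` A \<inter> space lebesgue"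
    using ae by eventually_elim simp
  ultimately show "v -` A \<inter> space lebesgue \<in> sets lebesgue"
    by (intro completion.in_sets_AE[of "u -` A \<inter> space lebesgue" "v -` A \<inter> space lebesgue"])
      (simp_all add: eq_commute)
qed simp

lemma lebesgue_integrable_cong_AE':
  fixes u v :: "'a::euclidean_space \<Rightarrow> real"
  assumes "AE x in lebesgue. u x = v x"
  shows "integrable lebesgue u \<longleftrightarrow> integrable lebesgue v"
proof -
  have "AE x in lebesgue. v x = u x"
    using assms by eventually_elim simp
  with assms show ?thesis
    using integrable_cong_AE_imp[of lebesgue u v] integrable_cong_AE_imp[of lebesgue v u]
      lebesgue_measurable_cong_AE[of u v] lebesgue_measurable_cong_AE[of v u]
      borel_measurable_integrable[of lebesgue u] borel_measurable_integrable[of lebesgue v]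
    by argo
qed

lemma lebesgue_integral_cong_AE':
  fixes u v :: "'a::euclidean_space \<Rightarrow> real"
  assumes "AE x in lebesgue. u x = v x"
  shows "integral\<^sup>L lebesgue u = integral\<^sup>L lebesgue v"
proof (cases "integrable lebesgue u")
  case True
  with assms lebesgue_integrable_cong_AE' have "integrable lebesgue v" by blast
  with True assms show ?thesis by (intro integral_cong_AE) auto
next
  case False
  with assms lebesgue_integrable_cong_AE' have "\<not> integrable lebesgue v" by blast
  with False show ?thesis by (simp add: not_integrable_integral_eq)
qed

quotient_type (overloaded) 'a aefun = "'a::euclidean_space \<Rightarrow> real" /
  "\<lambda>u v. AE x in lebesgue. u x = v x"
proof (rule equivpI)
  show "reflp (\<lambda>u v::'a \<Rightarrow> real. AE x in lebesgue. u x = v x)"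
    by (simp add: reflp_def)
  show "symp (\<lambda>u v::'a \<Rightarrow> real. AE x in lebesgue. u x = v x)"
    by (rule sympI, erule eventually_mono, simp)
  show "transp (\<lambda>u v::'a \<Rightarrow> real. AE x in lebesgue. u x = v x)"
    by (rule transpI, erule (1) eventually_elim2, simp)
qed

instantiation aefun :: (euclidean_space) real_vector
begin

lift_definition zero_aefun :: "'a aefun" is "\<lambda>x. 0" .

lift_definition plus_aefun :: "'a aefun \<Rightarrow> 'a aefun \<Rightarrow> 'a aefun" is "\<lambda>u v x. u x + v x"
  by (erule (1) eventually_elim2) simp

lift_definition uminus_aefun :: "'a aefun \<Rightarrow> 'a aefun" is "\<lambda>u x. - u x"
  by (erule eventually_mono) simp

lift_definition minus_aefun :: "'a aefun \<Rightarrow> 'a aefun \<Rightarrow> 'a aefun" is "\<lambda>u v x. u x - v x"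
  by (erule (1) eventually_elim2) simp

lift_definition scaleR_aefun :: "real \<Rightarrow> 'a aefun \<Rightarrow> 'a aefun" is "\<lambda>c u x. c * u x"
  by (erule eventually_mono) simp

instance
proof
  fix u v w :: "'a aefun" and b c :: real
  show "u + v + w = u + (v + w)" by transfer (simp add: add.assoc)
  show "u + v = v + u" by transfer (simp add: add.commute)
  show "0 + u = u" by transfer simp
  show "- u + u = 0" by transfer simp
  show "u - v = u + - v" by transfer simp
  show "c *\<^sub>R (u + v) = c *\<^sub>R u + c *\<^sub>R v" by transfer (simp add: distrib_left)
  show "(b + c) *\<^sub>R u = b *\<^sub>R u + c *\<^sub>R u" by transfer (simp add: distrib_right)
  show "b *\<^sub>R c *\<^sub>R u = (b * c) *\<^sub>R u" by transfer (simp add: mult.assoc)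
  show "1 *\<^sub>R u = u" by transfer simp
qed

end

lift_definition const_ae :: "real \<Rightarrow> 'a::euclidean_space aefun" is "\<lambda>c x. c" .

lift_definition comp_ae :: "(real \<Rightarrow> real) \<Rightarrow> 'a::euclidean_space aefun \<Rightarrow> 'a aefun"
  is "\<lambda>f u x. f (u x)"
  by (erule eventually_mono) simp

lift_definition convol_ae :: "('a::euclidean_space \<Rightarrow> real) \<Rightarrow> 'a aefun \<Rightarrow> 'a aefun"
  is "\<lambda>J v x. \<integral>y. J (x - y) * v y \<partial>lebesgue"
  by (rule always_eventually, rule allI, rule lebesgue_integral_cong_AE') (erule eventually_mono, simp)

lift_definition locally_integrable_ae :: "'a::euclidean_space aefun \<Rightarrow> bool"
  is "\<lambda>u. \<forall>C. compact C \<longrightarrow> set_integrable lebesgue C u"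
  unfolding set_integrable_def
  by (intro all_cong lebesgue_integrable_cong_AE') (erule eventually_mono, simp)

lift_definition p_integrable_ae :: "real \<Rightarrow> ('a::euclidean_space \<Rightarrow> real) \<Rightarrow> 'a aefun \<Rightarrow> bool"
  is "\<lambda>p \<rho> u. integrable lebesgue (\<lambda>x. \<bar>u x\<bar> powr p * \<rho> x)"
  by (intro lebesgue_integrable_cong_AE') (erule eventually_mono, simp)

lift_definition Lp_norm :: "real \<Rightarrow> ('a::euclidean_space \<Rightarrow> real) \<Rightarrow> 'a aefun \<Rightarrow> real"
  is "\<lambda>p \<rho> u. (\<integral>x. \<bar>u x\<bar> powr p * \<rho> x \<partial>lebesgue) powr (1 / p)"
  by (intro arg_cong[where f = "\<lambda>r. r powr _"] lebesgue_integral_cong_AE') (erule eventually_mono, simp)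

definition Lp :: "real \<Rightarrow> ('a::euclidean_space \<Rightarrow> real) \<Rightarrow> 'a aefun set"
  where "Lp p \<rho> = {u. locally_integrable_ae u \<and> p_integrable_ae p \<rho> u}"

definition Lp_dist :: "real \<Rightarrow> ('a::euclidean_space \<Rightarrow> real) \<Rightarrow> 'a aefun \<Rightarrow> 'a aefun \<Rightarrow> real"
  where "Lp_dist p \<rho> u v = Lp_norm p \<rho> (u - v)"

definition neural_rhs ::
    "('a::euclidean_space \<Rightarrow> real) \<Rightarrow> (real \<Rightarrow> real) \<Rightarrow> real \<Rightarrow> 'a aefun \<Rightarrow> 'a aefun"
  where "neural_rhs J f h u = - u + convol_ae J (comp_ae f u) + const_ae h"

text \<open>
  Forward-global solutions: the derivative is the limit of difference quotients in the weighted
  \<open>L\<^sup>p\<close> norm, one-sided at time 0.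
\<close>

definition Lp_ode_solution ::
    "real \<Rightarrow> ('a::euclidean_space \<Rightarrow> real) \<Rightarrow> ('a aefun \<Rightarrow> 'a aefun) \<Rightarrow> (real \<Rightarrow> 'a aefun) \<Rightarrow> bool"
  where "Lp_ode_solution p \<rho> F u \<longleftrightarrow>
    (\<forall>t\<ge>0. u t \<in> Lp p \<rho> \<and>
      ((\<lambda>s. Lp_norm p \<rho> ((1 / (s - t)) *\<^sub>R (u s - u t) - F (u t))) \<longlongrightarrow> 0) (at t within {0..}))"

definition Lp_flow ::
    "real \<Rightarrow> ('a::euclidean_space \<Rightarrow> real) \<Rightarrow> ('a aefun \<Rightarrow> 'a aefun) \<Rightarrow> real \<Rightarrow> 'a aefun \<Rightarrow> 'a aefun"
  where "Lp_flow p \<rho> F t u0 = (THE w. \<exists>u. Lp_ode_solution p \<rho> F u \<and> u 0 = u0 \<and> u t = w)"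

definition omega_limit :: "'b topology \<Rightarrow> (real \<Rightarrow> 'b \<Rightarrow> 'b) \<Rightarrow> 'b set \<Rightarrow> 'b set"
  where "omega_limit X S C = (\<Inter>s\<in>{0..}. X closure_of (\<Union>t\<in>{s..}. S t ` C))"

definition flow_invariant :: "(real \<Rightarrow> 'b \<Rightarrow> 'b) \<Rightarrow> 'b set \<Rightarrow> bool"
  where "flow_invariant S A \<longleftrightarrow> (\<forall>t\<ge>0. S t ` A = A)"

text \<open>
  The semidistance in the attraction property is taken in \<^typ>\<open>ennreal\<close>, so that the supremum
  over an empty or unbounded set and the infimum over an empty set have their usual values.
\<close>

definition global_attractor ::
    "'b set \<Rightarrow> ('b \<Rightarrow> 'b \<Rightarrow> real) \<Rightarrow> (real \<Rightarrow> 'b \<Rightarrow> 'b) \<Rightarrow> 'b set \<Rightarrow> bool"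
  where "global_attractor M d S A \<longleftrightarrow>
    compactin (Metric_space.mtopology M d) A \<and>
    flow_invariant S A \<and>
    (\<forall>B. Metric_space.mbounded M d B \<and> flow_invariant S B \<and> A \<subseteq> B \<longrightarrow> B = A) \<and>
    (\<forall>B. Metric_space.mbounded M d B \<longrightarrow>
      ((\<lambda>t. SUP b\<in>B. INF y\<in>A. ennreal (d (S t b) y)) \<longlongrightarrow> 0) at_top)"

text \<open>
  For differentiable \<open>J\<close> the Frechet derivative in the direction of the \<open>i\<close>-th unit vector
  is the \<open>i\<close>-th partial derivative.
\<close>

definition partial :: "'n::finite \<Rightarrow> (real^'n \<Rightarrow> real) \<Rightarrow> real^'n \<Rightarrow> real"
  where "partial i J x = frechet_derivative J (at x) (axis i 1)"

definition C1_fun :: "(real^'n::finite \<Rightarrow> real) \<Rightarrow> bool"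
  where "C1_fun J \<longleftrightarrow>
    (\<forall>x. J differentiable (at x)) \<and> (\<forall>i. continuous_on UNIV (partial i J))"

end

theory Submission
  imports Defs "HOL-Complex_Analysis.Great_Picard"
begin

text \<open>
  Write the solution as \<open>u(t) = e\<^sup>-\<^sup>t (u\<^sub>0 + W(t))\<close>, so that
  \<open>\<partial>\<^sub>t W = e\<^sup>t (J * f(u(t)) + h)\<close>.  Since \<open>J \<ge> 0\<close> and \<open>f\<close> is nondecreasing, Picard iteration from
  \<open>W = 0\<close> is monotone, and since \<open>f\<close> is bounded and \<open>J\<close> is Lipschitz with compact support, all iterates
  obey the same bounds and the same Lipschitz estimates in \<open>x\<close> and \<open>t\<close>; their pointwise limit solves
  the equation.  Hence \<open>S(t)u\<^sub>0 = e\<^sup>-\<^sup>t u\<^sub>0 + w(t)\<close> where \<open>w(t)\<close> takes values in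
  \<open>[0, a\<parallel>J\<parallel>\<^sub>1 + h]\<close> and is Lipschitz with a constant independent of \<open>u\<^sub>0\<close> and \<open>t\<close>.  Such functions
  form a family that is compact for pointwise convergence and therefore, by dominated convergence,
  in the weighted \<open>L\<^sup>p\<close> space; this gives both absorption and asymptotic compactness.

  Uniqueness and continuous dependence are proved in the weaker norm of \<open>L\<^sup>1(\<rho>)\<close>, in which the
  right-hand side is Lipschitz by Tonelli's theorem and the comparability of \<open>\<rho>\<close> at distance at
  most one.  Since the remainders \<open>w(t)\<close> are uniformly bounded, \<open>L\<^sup>1(\<rho>)\<close> continuity of the flow
  upgrades to \<open>L\<^sup>p(\<rho>)\<close> continuity.
\<close>

section \<open>Omega-limit sets of dissipative semigroups\<close>

text \<open>The flow is a definite description, so nothing can be said about it before existence and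
  uniqueness are both known. Existence is obtained pointwise in \<open>x\<close> for a fixed Borel
  representative of the initial state, so completeness of the weighted space does not enter. The
  factor \<open>exp t\<close> removes the term \<open>-u\<close>, the one part of the right-hand
  side that is decreasing in \<open>u\<close> and would spoil a monotone iteration. Every bound on
  \<open>W\<close> then carries a factor \<open>exp t - 1\<close>, which \<open>exp (- t)\<close>
  turns into a bound uniform in time. Continuous dependence is sought in \<open>L^1(\<rho>)\<close>
  because there the convolution is estimated by exchanging two integrals, with no convolution
  inequality for general \<open>p\<close>. Since \<open>\<rho>\<close> has total mass 1, a pointwise
  bound is also a norm bound, so all remainders lie in the ball of radius
  \<open>R0 = a * mass + h\<close>. The hypothesis on \<open>\<rho>\<close> at equal points forces
  \<open>1 \<le> K\<close>, hence \<open>R0 \<le> R < R + \<epsilon>\<close>: the gap makes the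
  larger ball absorbing, and letting \<open>exp (- t)\<close> vanish puts the attractor inside the
  ball of radius \<open>R0\<close>.\<close>

locale dissipative_semigroup = Metric_space M d
  for M :: "'b set" and d :: "'b \<Rightarrow> 'b \<Rightarrow> real" +
  fixes S :: "real \<Rightarrow> 'b \<Rightarrow> 'b" and B :: "'b set"
  assumes S_closed: "0 \<le> t \<Longrightarrow> x \<in> M \<Longrightarrow> S t x \<in> M"
    and S_add: "0 \<le> s \<Longrightarrow> 0 \<le> t \<Longrightarrow> x \<in> M \<Longrightarrow> S (s + t) x = S s (S t x)"
    and S_cont: "0 \<le> t \<Longrightarrow> x \<in> M \<Longrightarrow> (\<And>n. \<sigma> n \<in> M) \<Longrightarrow> (\<lambda>n. d (\<sigma> n) x) \<longlonglongrightarrow> 0 \<Longrightarrow>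
      (\<lambda>n::nat. d (S t (\<sigma> n)) (S t x)) \<longlonglongrightarrow> 0"
    and asymptotically_compact: "mbounded C \<Longrightarrow> (\<And>n. c n \<in> C) \<Longrightarrow> (\<And>n. 0 \<le> \<tau> n) \<Longrightarrow>
      filterlim \<tau> at_top sequentially \<Longrightarrow>
      \<exists>r y. strict_mono (r::nat \<Rightarrow> nat) \<and> y \<in> M \<and> (\<lambda>n. d (S (\<tau> (r n)) (c (r n))) y) \<longlonglongrightarrow> 0"
    and B_bounded: "mbounded B"
    and B_absorbing: "mbounded C \<Longrightarrow> \<exists>T\<ge>0. \<forall>t\<ge>T. S t ` C \<subseteq> B"
begin

abbreviation \<Omega> :: "'b set" where "\<Omega> \<equiv> omega_limit mtopology S B"

lemma B_subset: "B \<subseteq> M"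
  using B_bounded by (rule mbounded_subset_mspace)

lemma mem_omega_iff:
  "y \<in> \<Omega> \<longleftrightarrow> y \<in> M \<and> (\<forall>s\<ge>0. \<forall>e>0. \<exists>t\<ge>s. \<exists>b\<in>B. d (S t b) y < e)"
proof
  assume "y \<in> \<Omega>"
  then have *: "y \<in> mtopology closure_of (\<Union>t\<in>{s..}. S t ` B)" if "0 \<le> s" for s
    using that by (auto simp: omega_limit_def)
  from *[of 0] have "y \<in> M" by (simp add: metric_closure_of)
  moreover have "\<exists>t\<ge>s. \<exists>b\<in>B. d (S t b) y < e" if "0 \<le> s" "0 < e" for s e
  proof -
    from *[OF that(1)] that(2) obtain z where z: "z \<in> (\<Union>t\<in>{s..}. S t ` B)" "z \<in> mball y e"
      unfolding metric_closure_of by blast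
    then obtain t b where "s \<le> t" "b \<in> B" "z = S t b" by auto
    with z(2) show ?thesis using commute[of y z] by auto
  qed
  ultimately show "y \<in> M \<and> (\<forall>s\<ge>0. \<forall>e>0. \<exists>t\<ge>s. \<exists>b\<in>B. d (S t b) y < e)" by blast
next
  assume y: "y \<in> M \<and> (\<forall>s\<ge>0. \<forall>e>0. \<exists>t\<ge>s. \<exists>b\<in>B. d (S t b) y < e)"
  have "y \<in> mtopology closure_of (\<Union>t\<in>{s..}. S t ` B)" if "0 \<le> s" for s
    unfolding metric_closure_of
  proof (intro CollectI conjI allI impI)
    fix r :: real assume "0 < r"
    with y that obtain t b where "t \<ge> s" "b \<in> B" "d (S t b) y < r" by blast
    with that B_subset S_closed[of t b] y
    show "\<exists>z\<in>\<Union>t\<in>{s..}. S t ` B. z \<in> mball y r"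
      by (intro bexI[of _ "S t b"]) (auto simp: commute)
  qed (use y in blast)
  then show "y \<in> \<Omega>" by (auto simp: omega_limit_def)
qed

lemma omega_subset: "\<Omega> \<subseteq> M"
  using mem_omega_iff by blast

text \<open>Membership in \<open>B\<close> is required only eventually, because the starting points
  used later are orbit points that enter \<open>B\<close> after the absorption time.\<close>

lemma omega_memI:
  assumes y: "y \<in> M" and \<tau>: "filterlim \<tau> at_top sequentially"
    and b: "eventually (\<lambda>n. b n \<in> B) sequentially"
    and lim: "(\<lambda>n. d (S (\<tau> n) (b n)) y) \<longlonglongrightarrow> 0"
  shows "y \<in> \<Omega>"
  unfolding mem_omega_iff
proof (intro conjI allI impI y)
  fix s e :: real assume "0 \<le> s" "0 < e"
  have "eventually (\<lambda>n. d (S (\<tau> n) (b n)) y < e) sequentially"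
    using lim \<open>0 < e\<close> by (rule order_tendstoD)
  moreover have "eventually (\<lambda>n. s \<le> \<tau> n) sequentially"
    using \<tau> by (simp add: filterlim_at_top)
  ultimately have "eventually (\<lambda>n. s \<le> \<tau> n \<and> b n \<in> B \<and> d (S (\<tau> n) (b n)) y < e) sequentially"
    using b by eventually_elim blast
  then obtain n where "s \<le> \<tau> n" "b n \<in> B" "d (S (\<tau> n) (b n)) y < e"
    using eventually_happens'[OF sequentially_bot] by blast
  then show "\<exists>t\<ge>s. \<exists>b\<in>B. d (S t b) y < e" by blast
qed

text \<open>The explicit bound \<open>real n \<le> \<tau> n\<close> keeps all times nonnegative,
  which the semigroup law demands, besides forcing divergence.\<close>

lemma omega_memE:
  assumes "y \<in> \<Omega>"
  obtains \<tau> b where "\<And>n::nat. real n \<le> \<tau> n" "filterlim \<tau> at_top sequentially" "\<And>n. b n \<in> B"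
    "(\<lambda>n. d (S (\<tau> n) (b n)) y) \<longlonglongrightarrow> 0"
proof -
  have "\<exists>t b. real n \<le> t \<and> b \<in> B \<and> d (S t b) y < inverse (real (Suc n))" for n
    using assms[unfolded mem_omega_iff, THEN conjunct2, rule_format,
        of "real n" "inverse (real (Suc n))"] by auto
  then obtain \<tau> b where *: "\<And>n. real n \<le> \<tau> n" "\<And>n. b n \<in> B"
    "\<And>n. d (S (\<tau> n) (b n)) y < inverse (real (Suc n))"
    by metis
  have "filterlim \<tau> at_top sequentially"
    by (rule filterlim_at_top_mono[OF filterlim_real_sequentially]) (simp add: *)
  moreover have "(\<lambda>n. d (S (\<tau> n) (b n)) y) \<longlonglongrightarrow> 0"
    by (rule tendsto_sandwich[OF _ _ tendsto_const LIMSEQ_inverse_real_of_nat])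
      (use *(3) less_imp_le in \<open>auto intro!: always_eventually\<close>)
  ultimately show ?thesis using that * by blast
qed

text \<open>Split each time in two halves. After the first half the orbit of \<open>C\<close> has
  been absorbed by \<open>B\<close>; the second half still tends to infinity, so the limit is an
  omega-limit point of \<open>B\<close> although \<open>C\<close> need not lie in
  \<open>B\<close>.\<close>

lemma bounded_orbit_limit:
  assumes C: "mbounded C" and c: "\<And>n. c n \<in> C" and \<tau>0: "\<And>n. 0 \<le> \<tau> n"
    and \<tau>: "filterlim \<tau> at_top sequentially"
  obtains r y where "strict_mono (r::nat \<Rightarrow> nat)" "y \<in> \<Omega>"
    "(\<lambda>n. d (S (\<tau> (r n)) (c (r n))) y) \<longlonglongrightarrow> 0"
proof -
  obtain r y where r: "strict_mono r" and y: "y \<in> M"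
    and lim: "(\<lambda>n. d (S (\<tau> (r n)) (c (r n))) y) \<longlonglongrightarrow> 0"
    using asymptotically_compact[of C c \<tau>, OF C c \<tau>0 \<tau>] by (elim exE conjE) (rule that)
  have \<tau>r: "filterlim (\<lambda>n. \<tau> (r n)) at_top sequentially"
    using \<tau> filterlim_subseq[OF r] by (rule filterlim_compose)
  have half: "filterlim (\<lambda>n. \<tau> (r n) / 2) at_top sequentially"
    using filterlim_at_top_mult_tendsto_pos[OF tendsto_const[of "1/2"] _ \<tau>r] by simp
  obtain T where T: "\<And>t. t \<ge> T \<Longrightarrow> S t ` C \<subseteq> B"
    using B_absorbing[OF C] by blast
  have "eventually (\<lambda>n. T \<le> \<tau> (r n) / 2) sequentially"
    using half by (simp add: filterlim_at_top)
  then have ev: "eventually (\<lambda>n. S (\<tau> (r n) / 2) (c (r n)) \<in> B) sequentially"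
    by eventually_elim (use T c in blast)
  have "S (\<tau> (r n)) (c (r n)) = S (\<tau> (r n) / 2) (S (\<tau> (r n) / 2) (c (r n)))" for n
    using S_add[of "\<tau> (r n) / 2" "\<tau> (r n) / 2" "c (r n)"] \<tau>0[of "r n"] c
      mbounded_subset_mspace[OF C] by auto
  with lim have "(\<lambda>n. d (S (\<tau> (r n) / 2) (S (\<tau> (r n) / 2) (c (r n)))) y) \<longlonglongrightarrow> 0"
    by simp
  from omega_memI[OF y half ev this] r lim show ?thesis using that by blast
qed

text \<open>Each \<open>\<sigma> n\<close> is within \<open>1 / (n + 1)\<close> of an orbit point at
  a time at least \<open>n\<close>. A convergent subsequence of these orbit points drags
  \<open>\<sigma>\<close> along, and its limit already lies in \<open>\<Omega>\<close>, so
  closedness needs no separate argument.\<close>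

lemma omega_compact: "compactin mtopology \<Omega>"
  unfolding compactin_sequentially
proof (intro conjI allI impI omega_subset)
  fix \<sigma> :: "nat \<Rightarrow> 'b" assume "range \<sigma> \<subseteq> \<Omega>"
  then have \<sigma>: "\<sigma> n \<in> \<Omega>" for n by blast
  then have \<sigma>M: "\<sigma> n \<in> M" for n using omega_subset by blast
  have "\<exists>t b. real n \<le> t \<and> b \<in> B \<and> d (S t b) (\<sigma> n) < inverse (real (Suc n))" for n
    using \<sigma>[of n, unfolded mem_omega_iff, THEN conjunct2, rule_format,
        of "real n" "inverse (real (Suc n))"] by auto
  then obtain \<tau> b where *: "\<And>n. real n \<le> \<tau> n" "\<And>n. b n \<in> B"
    "\<And>n. d (S (\<tau> n) (b n)) (\<sigma> n) < inverse (real (Suc n))"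
    by metis
  have \<tau>: "filterlim \<tau> at_top sequentially"
    by (rule filterlim_at_top_mono[OF filterlim_real_sequentially]) (simp add: *)
  have \<tau>0: "0 \<le> \<tau> n" for n using *(1)[of n] by linarith
  obtain r y where r: "strict_mono (r::nat \<Rightarrow> nat)" and y: "y \<in> \<Omega>"
    and lim: "(\<lambda>n. d (S (\<tau> (r n)) (b (r n))) y) \<longlonglongrightarrow> 0"
    by (rule bounded_orbit_limit[OF B_bounded *(2) \<tau>0 \<tau>])
  have yM: "y \<in> M" using y omega_subset by blast
  have inv: "(\<lambda>n. inverse (real (Suc (r n)))) \<longlonglongrightarrow> 0"
    using LIMSEQ_subseq_LIMSEQ[OF LIMSEQ_inverse_real_of_nat r] by (simp add: o_def)
  have "(\<lambda>n. d (\<sigma> (r n)) y) \<longlonglongrightarrow> 0"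
  proof (rule tendsto_sandwich[OF _ _ tendsto_const])
    show "(\<lambda>n. inverse (real (Suc (r n))) + d (S (\<tau> (r n)) (b (r n))) y) \<longlonglongrightarrow> 0"
      using tendsto_add[OF inv lim] by simp
    have "d (\<sigma> (r n)) y \<le> inverse (real (Suc (r n))) + d (S (\<tau> (r n)) (b (r n))) y" for n
    proof -
      have "S (\<tau> (r n)) (b (r n)) \<in> M" using S_closed \<tau>0 *(2) B_subset by blast
      then have "d (\<sigma> (r n)) y \<le> d (\<sigma> (r n)) (S (\<tau> (r n)) (b (r n))) + d (S (\<tau> (r n)) (b (r n))) y"
        using triangle \<sigma>M yM by blast
      with *(3)[of "r n"] show ?thesis by (simp add: commute)
    qed
    then show "\<forall>\<^sub>F n in sequentially.
        d (\<sigma> (r n)) y \<le> inverse (real (Suc (r n))) + d (S (\<tau> (r n)) (b (r n))) y"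
      by (rule always_eventually[OF allI])
  qed simp
  then have "limitin mtopology (\<sigma> \<circ> r) y sequentially"
    by (simp add: limitin_metric_dist_null yM \<sigma>M)
  with y r show "\<exists>l r. l \<in> \<Omega> \<and> strict_mono r \<and> limitin mtopology (\<sigma> \<circ> r) l sequentially"
    by blast
qed

text \<open>Forward invariance is continuity of \<open>S t\<close>. For the converse, a preimage of
  \<open>y\<close> under \<open>S t\<close> is found as a limit of the same orbits stopped
  \<open>t\<close> units earlier; asymptotic compactness provides that limit.\<close>

lemma omega_invariant: "flow_invariant S \<Omega>"
  unfolding flow_invariant_def
proof (intro allI impI equalityI subsetI)
  fix t y assume t: "(0::real) \<le> t" and "y \<in> S t ` \<Omega>"
  then obtain z where z: "z \<in> \<Omega>" "y = S t z" by blast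
  then have zM: "z \<in> M" using omega_subset by blast
  obtain \<tau> b where \<tau>: "\<And>n::nat. real n \<le> \<tau> n" "filterlim \<tau> at_top sequentially"
    and b: "\<And>n. b n \<in> B" and lim: "(\<lambda>n. d (S (\<tau> n) (b n)) z) \<longlonglongrightarrow> 0"
    using omega_memE[OF z(1)] by metis
  have \<tau>0: "0 \<le> \<tau> n" for n using \<tau>(1)[of n] by linarith
  have bM: "b n \<in> M" for n using b B_subset by blast
  have "(\<lambda>n. d (S t (S (\<tau> n) (b n))) (S t z)) \<longlonglongrightarrow> 0"
    by (rule S_cont[OF t zM S_closed[OF \<tau>0 bM] lim])
  then have "(\<lambda>n. d (S (t + \<tau> n) (b n)) (S t z)) \<longlonglongrightarrow> 0"
    by (simp add: S_add[OF t \<tau>0 bM])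
  moreover have "filterlim (\<lambda>n. t + \<tau> n) at_top sequentially"
    by (rule filterlim_tendsto_add_at_top[OF tendsto_const \<tau>(2)])
  ultimately show "y \<in> \<Omega>"
    using omega_memI[OF S_closed[OF t zM], of "\<lambda>n. t + \<tau> n" b] b z(2) by (simp add: always_eventually)
next
  fix t y assume t: "(0::real) \<le> t" and y: "y \<in> \<Omega>"
  then have yM: "y \<in> M" using omega_subset by blast
  obtain \<tau> b where \<tau>: "\<And>n::nat. real n \<le> \<tau> n" "filterlim \<tau> at_top sequentially"
    and b: "\<And>n. b n \<in> B" and lim: "(\<lambda>n. d (S (\<tau> n) (b n)) y) \<longlonglongrightarrow> 0"
    using omega_memE[OF y] by metis
  have bM: "b n \<in> M" for n using b B_subset by blast
  \<comment> \<open>The cutoff at 0 covers the finitely many indices with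
    \<open>\<tau> n < t\<close>, where the earlier position does not exist.\<close>
  define s where "s n = max 0 (\<tau> n - t)" for n
  have "filterlim (\<lambda>n. - t + \<tau> n) at_top sequentially"
    by (rule filterlim_tendsto_add_at_top[OF tendsto_const \<tau>(2)])
  then have s: "filterlim s at_top sequentially"
    by (rule filterlim_at_top_mono) (simp add: s_def always_eventually)
  have s0: "0 \<le> s n" for n by (simp add: s_def)
  obtain r z where r: "strict_mono (r::nat \<Rightarrow> nat)" and z: "z \<in> \<Omega>"
    and limz: "(\<lambda>n. d (S (s (r n)) (b (r n))) z) \<longlonglongrightarrow> 0"
    by (rule bounded_orbit_limit[OF B_bounded b s0 s])
  have zM: "z \<in> M" using z omega_subset by blast
  have 1: "(\<lambda>n. d (S t (S (s (r n)) (b (r n)))) (S t z)) \<longlonglongrightarrow> 0"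
    by (rule S_cont[OF t zM S_closed[OF s0 bM] limz])
  have 2: "(\<lambda>n. d (S (\<tau> (r n)) (b (r n))) y) \<longlonglongrightarrow> 0"
    using LIMSEQ_subseq_LIMSEQ[OF lim r] by (simp add: o_def)
  have "eventually (\<lambda>n. t \<le> \<tau> (r n)) sequentially"
    using filterlim_compose[OF \<tau>(2) filterlim_subseq[OF r]] by (simp add: filterlim_at_top)
  then have "eventually (\<lambda>n. d (S t z) y \<le>
      d (S t (S (s (r n)) (b (r n)))) (S t z) + d (S (\<tau> (r n)) (b (r n))) y) sequentially"
  proof eventually_elim
    fix n assume n: "t \<le> \<tau> (r n)"
    then have "S (\<tau> (r n)) (b (r n)) = S t (S (s (r n)) (b (r n)))"
      using S_add[OF t s0[of "r n"] bM[of "r n"]] by (simp add: s_def)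
    then show "d (S t z) y \<le>
        d (S t (S (s (r n)) (b (r n)))) (S t z) + d (S (\<tau> (r n)) (b (r n))) y"
      using triangle[OF S_closed[OF t zM] S_closed[OF t S_closed[OF s0 bM]] yM]
      by (simp add: commute)
  qed
  then have "d (S t z) y \<le> 0 + 0"
    by (intro tendsto_le[OF sequentially_bot tendsto_add[OF 1 2] tendsto_const])
  then have "y = S t z"
    using zero[OF S_closed[OF t zM] yM] nonneg[of "S t z" y] by simp
  with z show "y \<in> S t ` \<Omega>" by blast
qed

text \<open>Invariance acts twice: the image of \<open>C\<close> at a late time is \<open>C\<close>
  and lies in \<open>B\<close>, and every point of \<open>C\<close> is the image at each time
  \<open>s\<close> of a point of \<open>C\<close>, so orbits from \<open>B\<close> hit it
  exactly.\<close>

lemma omega_maximal: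
  assumes C: "mbounded C" "flow_invariant S C"
  shows "C \<subseteq> \<Omega>"
proof
  fix y assume y: "y \<in> C"
  obtain T where T: "T \<ge> 0" "\<And>t. t \<ge> T \<Longrightarrow> S t ` C \<subseteq> B"
    using B_absorbing[OF C(1)] by blast
  have inv: "S t ` C = C" if "0 \<le> t" for t
    using C(2) that by (auto simp: flow_invariant_def)
  then have "C \<subseteq> B" using T by (metis order_refl)
  have yM: "y \<in> M" using y C(1) mbounded_subset_mspace by blast
  show "y \<in> \<Omega>"
    unfolding mem_omega_iff
  proof (intro conjI allI impI yM)
    fix s e :: real assume s: "0 \<le> s" "0 < e"
    then obtain b where "b \<in> C" "y = S s b" using inv y by blast
    with s yM \<open>C \<subseteq> B\<close> show "\<exists>t\<ge>s. \<exists>b\<in>B. d (S t b) y < e"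
      by (intro exI[of _ s] conjI bexI[of _ b]) auto
  qed
qed

text \<open>If attraction failed, there would be orbit points at times tending to infinity that stay
  a fixed distance away from all of \<open>\<Omega>\<close>, contrary to
  \<open>bounded_orbit_limit\<close>.\<close>

lemma omega_attracts:
  assumes C: "mbounded C"
  shows "((\<lambda>t. SUP b\<in>C. INF y\<in>\<Omega>. ennreal (d (S t b) y)) \<longlongrightarrow> 0) at_top"
proof (rule ccontr)
  define D where "D t = (SUP b\<in>C. INF y\<in>\<Omega>. ennreal (d (S t b) y))" for t
  assume "\<not> ?thesis"
  then have nl: "\<not> (D \<longlongrightarrow> 0) at_top" by (simp add: D_def[abs_def])
  then obtain e where e: "0 < e" "\<not> eventually (\<lambda>t. D t < e) at_top"
    using order_tendstoI[of 0 D at_top] by (metis not_less_zero)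
  have "\<exists>t\<ge>real n. e \<le> D t" for n :: nat
    using e(2) by (auto simp: eventually_at_top_linorder not_less)
  then obtain \<tau> where \<tau>: "\<And>n::nat. real n \<le> \<tau> n" "\<And>n. e \<le> D (\<tau> n)" by metis
  \<comment> \<open>\<open>e\<close> is extended and possibly infinite. A real number strictly below
    it yields a witness from the supremum and can be compared with real distances.\<close>
  obtain x where x: "0 < x" "x < e" using dense[OF e(1)] by blast
  then obtain \<delta> where x_eq: "x = ennreal \<delta>" "0 \<le> \<delta>" by (cases x) auto
  with x have \<delta>: "0 < \<delta>" "ennreal \<delta> < e" by auto
  have "\<exists>c\<in>C. ennreal \<delta> < (INF y\<in>\<Omega>. ennreal (d (S (\<tau> n) c) y))" for n
    using less_le_trans[OF \<delta>(2) \<tau>(2)[of n]] unfolding D_def less_SUP_iff .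
  then obtain c where c: "\<And>n. c n \<in> C"
    "\<And>n. ennreal \<delta> < (INF y\<in>\<Omega>. ennreal (d (S (\<tau> n) (c n)) y))" by metis
  have \<tau>0: "0 \<le> \<tau> n" for n using \<tau>(1)[of n] by linarith
  have \<tau>lim: "filterlim \<tau> at_top sequentially"
    by (rule filterlim_at_top_mono[OF filterlim_real_sequentially]) (simp add: \<tau>)
  obtain r y where "strict_mono (r::nat \<Rightarrow> nat)" and y: "y \<in> \<Omega>"
    and lim: "(\<lambda>n. d (S (\<tau> (r n)) (c (r n))) y) \<longlonglongrightarrow> 0"
    by (rule bounded_orbit_limit[OF C c(1) \<tau>0 \<tau>lim])
  have "ennreal \<delta> < ennreal (d (S (\<tau> (r n)) (c (r n))) y)" for n
    using less_le_trans[OF c(2) INF_lower[OF y]] .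
  then have "\<delta> \<le> d (S (\<tau> (r n)) (c (r n))) y" for n
    using \<delta>(1) by (metis ennreal_less_iff less_imp_le)
  then have "\<delta> \<le> 0" by (intro LIMSEQ_le_const[OF lim]) blast
  with \<delta>(1) show False by simp
qed

theorem omega_global_attractor: "global_attractor M d S \<Omega>"
  unfolding global_attractor_def
  using omega_compact omega_invariant omega_maximal omega_attracts by blast

end

section \<open>Weighted Lebesgue spaces\<close>

text \<open>Convexity of the power is invoked for positive arguments; if one argument is 0, the
  claim reduces to \<open>r powr q \<le> r\<close> on the unit interval.\<close>

lemma powr_convex_combination:
  fixes x y s q :: real
  assumes "0 \<le> x" "0 \<le> y" "0 \<le> s" "s \<le> 1" "1 \<le> q"
  shows "(s * x + (1 - s) * y) powr q \<le> s * x powr q + (1 - s) * y powr q"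
proof -
  have *: "r powr q \<le> r" if "0 \<le> r" "r \<le> 1" for r :: real
    using that assms(5) powr_mono'[of 1 q r] by simp
  consider "x = 0" | "y = 0" | "0 < x" "0 < y" using assms by linarith
  then show ?thesis
  proof cases
    case 1
    then show ?thesis
      using *[of "1 - s"] assms by (auto simp: powr_mult intro!: mult_right_mono)
  next
    case 2
    then show ?thesis
      using *[of s] assms by (auto simp: powr_mult intro!: mult_right_mono)
  next
    case 3
    then show ?thesis
      using convex_onD[OF powr_convex[OF \<open>1 \<le> q\<close>], of "1 - s" x y] assms by simp
  qed
qed

text \<open>The type of classes carries no measurability, so it is recovered here: the function is
  the pointwise limit of its truncations to growing balls.\<close>

lemma locally_integrable_measurable:
  fixes u :: "'a::euclidean_space \<Rightarrow> real"
  assumes "\<And>C. compact C \<Longrightarrow> set_integrable lebesgue C u"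
  shows "u \<in> borel_measurable lebesgue"
proof (rule borel_measurable_LIMSEQ_real)
  show "(\<lambda>x. indicator (cball 0 (real n)) x *\<^sub>R u x) \<in> borel_measurable lebesgue" for n
    using assms[of "cball 0 (real n)"] unfolding set_integrable_def by auto
  fix x :: 'a
  obtain N :: nat where N: "norm x \<le> real N" using real_arch_simple by blast
  have "eventually (\<lambda>n. indicator (cball 0 (real n)) x *\<^sub>R u x = u x) sequentially"
    using eventually_ge_at_top[of N] by eventually_elim (use N in \<open>auto simp: indicator_def\<close>)
  then show "(\<lambda>n. indicator (cball 0 (real n)) x *\<^sub>R u x) \<longlonglongrightarrow> u x"
    by (rule tendsto_eventually)
qed

lemma plus_abs_aefun: "abs_aefun u + abs_aefun v = abs_aefun (\<lambda>x. u x + v x)"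
  by (rule plus_aefun.abs_eq)

lemma minus_abs_aefun: "abs_aefun u - abs_aefun v = abs_aefun (\<lambda>x. u x - v x)"
  by (rule minus_aefun.abs_eq)

lemma scaleR_abs_aefun: "c *\<^sub>R abs_aefun u = abs_aefun (\<lambda>x. c * u x)"
  by (rule scaleR_aefun.abs_eq)

lemma zero_abs_aefun: "0 = abs_aefun (\<lambda>x. 0)"
  by (simp add: zero_aefun_def)

lemma aefun_exhaust: obtains u where "U = abs_aefun u"
  by (induct U rule: aefun.abs_induct) blast

text \<open>The exponent 1 is allowed so that the same development can be instantiated for
  \<open>L^1(\<rho>)\<close>, where uniqueness is proved.\<close>

locale weighted_Lp =
  fixes p :: real and \<rho> :: "'a::euclidean_space \<Rightarrow> real"
  assumes p: "1 \<le> p"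
    and \<rho>_integrable: "integrable lebesgue \<rho>"
    and \<rho>_pos: "\<And>x. 0 < \<rho> x"
    and \<rho>_int: "(\<integral>x. \<rho> x \<partial>lebesgue) = 1"
begin

lemma \<rho>_measurable [measurable]: "\<rho> \<in> borel_measurable lebesgue"
  using \<rho>_integrable by auto

lemma \<rho>_nonneg [simp]: "0 \<le> \<rho> x"
  using \<rho>_pos[of x] by simp

lemma abs_in_Lp_iff:
  "abs_aefun u \<in> Lp p \<rho> \<longleftrightarrow> (\<forall>C. compact C \<longrightarrow> set_integrable lebesgue C u) \<and>
    integrable lebesgue (\<lambda>x. \<bar>u x\<bar> powr p * \<rho> x)"
  by (simp add: Lp_def locally_integrable_ae.abs_eq p_integrable_ae.abs_eq)

lemma Lp_norm_abs: "Lp_norm p \<rho> (abs_aefun u) = (\<integral>x. \<bar>u x\<bar> powr p * \<rho> x \<partial>lebesgue) powr (1 / p)"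
  by (simp add: Lp_norm.abs_eq)

lemma Lp_norm_nonneg: "0 \<le> Lp_norm p \<rho> U"
  by (cases U rule: aefun_exhaust) (simp add: Lp_norm_abs)

lemma Lp_measurable:
  "abs_aefun u \<in> Lp p \<rho> \<Longrightarrow> u \<in> borel_measurable lebesgue"
  using locally_integrable_measurable abs_in_Lp_iff by blast

text \<open>Borel representatives are what Tonelli's theorem on the product of \<open>lborel\<close>
  with itself and the Picard construction work with.\<close>

lemma Lp_borel_cases:
  assumes "U \<in> Lp p \<rho>"
  obtains u where "U = abs_aefun u" "u \<in> borel_measurable borel"
proof -
  obtain v where v: "U = abs_aefun v" by (rule aefun_exhaust)
  then have "v \<in> borel_measurable lebesgue" using Lp_measurable assms by simp
  then obtain u where u: "u \<in> borel_measurable lborel" "AE x in lborel. v x = u x"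
    using completion_ex_borel_measurable_real by blast
  then have "AE x in lebesgue. v x = u x" by (auto intro: AE_completion)
  then have "U = abs_aefun u" using v by (simp add: aefun.abs_eq_iff)
  with u that show ?thesis by simp
qed

section \<open>Minkowski's inequality and the norm axioms\<close>

lemma integral_nonneg: "0 \<le> (\<integral>x. \<bar>u x\<bar> powr p * \<rho> x \<partial>lebesgue)"
  by (intro integral_nonneg_AE always_eventually) auto

lemma Lp_norm_abs_le_iff:
  assumes "0 \<le> c"
  shows "Lp_norm p \<rho> (abs_aefun u) \<le> c \<longleftrightarrow> (\<integral>x. \<bar>u x\<bar> powr p * \<rho> x \<partial>lebesgue) \<le> c powr p"
proof
  assume "Lp_norm p \<rho> (abs_aefun u) \<le> c"
  then have "Lp_norm p \<rho> (abs_aefun u) powr p \<le> c powr p"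
    using p by (intro powr_mono2) (auto simp: Lp_norm_nonneg)
  then show "(\<integral>x. \<bar>u x\<bar> powr p * \<rho> x \<partial>lebesgue) \<le> c powr p"
    using p integral_nonneg[of u] by (simp add: Lp_norm_abs powr_powr)
next
  assume "(\<integral>x. \<bar>u x\<bar> powr p * \<rho> x \<partial>lebesgue) \<le> c powr p"
  then have "Lp_norm p \<rho> (abs_aefun u) \<le> (c powr p) powr (1 / p)"
    using p unfolding Lp_norm_abs by (intro powr_mono2 integral_nonneg) auto
  then show "Lp_norm p \<rho> (abs_aefun u) \<le> c"
    using p assms by (simp add: powr_powr)
qed

text \<open>Convexity of \<open>t\<^sup>p\<close> with weights \<open>\<alpha> / (\<alpha> + \<beta>)\<close> and \<open>\<beta> / (\<alpha> + \<beta>)\<close>; integrated with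
  \<open>\<alpha>\<close>, \<open>\<beta>\<close> bounds for the two norms, this is Minkowski's inequality without Hoelder's.\<close>

lemma Minkowski_pointwise:
  fixes a b \<alpha> \<beta> :: real
  assumes "0 < \<alpha>" "0 < \<beta>"
  shows "\<bar>a + b\<bar> powr p \<le> (\<alpha> + \<beta>) powr p *
    (\<alpha> / (\<alpha> + \<beta>) * (\<bar>a\<bar> powr p / \<alpha> powr p) + \<beta> / (\<alpha> + \<beta>) * (\<bar>b\<bar> powr p / \<beta> powr p))"
proof -
  define s where "s = \<alpha> / (\<alpha> + \<beta>)"
  have s: "0 \<le> s" "s \<le> 1" "1 - s = \<beta> / (\<alpha> + \<beta>)"
    using assms by (auto simp: s_def field_simps)
  have "(\<alpha> + \<beta>) * (s * (\<bar>a\<bar> / \<alpha>) + (1 - s) * (\<bar>b\<bar> / \<beta>)) = \<bar>a\<bar> + \<bar>b\<bar>"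
  proof -
    have "(\<alpha> + \<beta>) * s = \<alpha>" "(\<alpha> + \<beta>) * (1 - s) = \<beta>"
      using assms unfolding s(3) by (auto simp: s_def)
    then show ?thesis
      using assms by (simp add: distrib_left mult.assoc[symmetric])
  qed
  then have "\<bar>a + b\<bar> \<le> (\<alpha> + \<beta>) * (s * (\<bar>a\<bar> / \<alpha>) + (1 - s) * (\<bar>b\<bar> / \<beta>))"
    using abs_triangle_ineq[of a b] by presburger
  then have "\<bar>a + b\<bar> powr p \<le> ((\<alpha> + \<beta>) * (s * (\<bar>a\<bar> / \<alpha>) + (1 - s) * (\<bar>b\<bar> / \<beta>))) powr p"
    using p by (intro powr_mono2) auto
  also have "\<dots> = (\<alpha> + \<beta>) powr p * (s * (\<bar>a\<bar> / \<alpha>) + (1 - s) * (\<bar>b\<bar> / \<beta>)) powr p"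
    using assms s by (intro powr_mult)
  also have "\<dots> \<le> (\<alpha> + \<beta>) powr p *
      (s * (\<bar>a\<bar> / \<alpha>) powr p + (1 - s) * (\<bar>b\<bar> / \<beta>) powr p)"
    using assms s p by (intro mult_left_mono powr_convex_combination) auto
  finally show ?thesis
    using assms by (simp add: powr_divide s(3) flip: s_def)
qed

text \<open>\<open>\<alpha>\<close> and \<open>\<beta>\<close> are positive upper bounds instead of
  the norms themselves, so that dividing by their powers is safe when a norm vanishes. The triangle
  inequality follows by shrinking the excess to 0.\<close>

lemma Lp_add_aux:
  assumes U: "abs_aefun u \<in> Lp p \<rho>" and V: "abs_aefun v \<in> Lp p \<rho>"
    and \<alpha>: "0 < \<alpha>" "Lp_norm p \<rho> (abs_aefun u) \<le> \<alpha>"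
    and \<beta>: "0 < \<beta>" "Lp_norm p \<rho> (abs_aefun v) \<le> \<beta>"
  shows "abs_aefun (\<lambda>x. u x + v x) \<in> Lp p \<rho> \<and>
    Lp_norm p \<rho> (abs_aefun (\<lambda>x. u x + v x)) \<le> \<alpha> + \<beta>"
proof -
  have [measurable]: "u \<in> borel_measurable lebesgue" "v \<in> borel_measurable lebesgue"
    using U V Lp_measurable by auto
  define A where "A = (\<alpha> + \<beta>) powr p * (\<alpha> / (\<alpha> + \<beta>) / \<alpha> powr p)"
  define B where "B = (\<alpha> + \<beta>) powr p * (\<beta> / (\<alpha> + \<beta>) / \<beta> powr p)"
  have AB: "0 \<le> A" "0 \<le> B" using \<alpha> \<beta> by (auto simp: A_def B_def)
  have iu: "integrable lebesgue (\<lambda>x. \<bar>u x\<bar> powr p * \<rho> x)"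
    and iv: "integrable lebesgue (\<lambda>x. \<bar>v x\<bar> powr p * \<rho> x)"
    using U V abs_in_Lp_iff by auto
  have le: "\<bar>u x + v x\<bar> powr p * \<rho> x \<le> A * (\<bar>u x\<bar> powr p * \<rho> x) + B * (\<bar>v x\<bar> powr p * \<rho> x)" for x
  proof -
    have "\<bar>u x + v x\<bar> powr p \<le> A * \<bar>u x\<bar> powr p + B * \<bar>v x\<bar> powr p"
      using Minkowski_pointwise[OF \<alpha>(1) \<beta>(1), of "u x" "v x"]
      by (simp add: A_def B_def algebra_simps)
    from mult_right_mono[OF this less_imp_le[OF \<rho>_pos]] show ?thesis
      by (simp add: algebra_simps)
  qed
  have i': "integrable lebesgue (\<lambda>x. A * (\<bar>u x\<bar> powr p * \<rho> x) + B * (\<bar>v x\<bar> powr p * \<rho> x))"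
    using iu iv by auto
  have i: "integrable lebesgue (\<lambda>x. \<bar>u x + v x\<bar> powr p * \<rho> x)"
    by (rule Bochner_Integration.integrable_bound[OF i'])
      (use le \<rho>_pos AB in \<open>auto intro!: always_eventually simp: abs_mult less_imp_le intro: order_trans[OF _ abs_ge_self]\<close>)
  have "set_integrable lebesgue C (\<lambda>x. u x + v x)" if "compact C" for C
    using U V that by (intro set_integral_add) (auto simp: abs_in_Lp_iff)
  with i have in_Lp: "abs_aefun (\<lambda>x. u x + v x) \<in> Lp p \<rho>" by (simp add: abs_in_Lp_iff)
  have "(\<integral>x. \<bar>u x + v x\<bar> powr p * \<rho> x \<partial>lebesgue) \<le>
      (\<integral>x. A * (\<bar>u x\<bar> powr p * \<rho> x) + B * (\<bar>v x\<bar> powr p * \<rho> x) \<partial>lebesgue)"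
    by (rule integral_mono[OF i i' le])
  also have "\<dots> = A * (\<integral>x. \<bar>u x\<bar> powr p * \<rho> x \<partial>lebesgue) + B * (\<integral>x. \<bar>v x\<bar> powr p * \<rho> x \<partial>lebesgue)"
    using iu iv by simp
  also have "\<dots> \<le> A * \<alpha> powr p + B * \<beta> powr p"
    using \<alpha> \<beta> AB by (intro add_mono mult_left_mono) (auto simp flip: Lp_norm_abs_le_iff)
  also have "\<dots> = (\<alpha> + \<beta>) powr p * (\<alpha> / (\<alpha> + \<beta>) + \<beta> / (\<alpha> + \<beta>))"
  proof -
    have "\<alpha> powr p \<noteq> 0" "\<beta> powr p \<noteq> 0" using \<alpha> \<beta> by auto
    then show ?thesis by (simp add: A_def B_def distrib_left)
  qed
  also have "\<dots> = (\<alpha> + \<beta>) powr p"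
    using \<alpha> \<beta> by (simp flip: add_divide_distrib)
  finally show ?thesis
    using \<alpha> \<beta> in_Lp by (simp add: Lp_norm_abs_le_iff)
qed

lemma Lp_add: "U \<in> Lp p \<rho> \<Longrightarrow> V \<in> Lp p \<rho> \<Longrightarrow> U + V \<in> Lp p \<rho>"
  using Lp_add_aux[of _ _ "max 1 (Lp_norm p \<rho> U)" "max 1 (Lp_norm p \<rho> V)"]
  by (cases U rule: aefun_exhaust, cases V rule: aefun_exhaust) (auto simp: plus_abs_aefun)

lemma Lp_norm_triangle:
  assumes "U \<in> Lp p \<rho>" "V \<in> Lp p \<rho>"
  shows "Lp_norm p \<rho> (U + V) \<le> Lp_norm p \<rho> U + Lp_norm p \<rho> V"
proof (rule field_le_epsilon)
  fix e :: real assume "0 < e"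
  then show "Lp_norm p \<rho> (U + V) \<le> Lp_norm p \<rho> U + Lp_norm p \<rho> V + e"
    using assms Lp_add_aux[of _ _ "Lp_norm p \<rho> U + e / 2" "Lp_norm p \<rho> V + e / 2"]
      Lp_norm_nonneg[of U] Lp_norm_nonneg[of V]
    by (cases U rule: aefun_exhaust, cases V rule: aefun_exhaust)
      (force simp: plus_abs_aefun add_nonneg_pos)
qed

lemma Lp_scaleR:
  assumes "U \<in> Lp p \<rho>" shows "c *\<^sub>R U \<in> Lp p \<rho>"
proof -
  obtain u where u: "U = abs_aefun u" by (rule aefun_exhaust)
  have "integrable lebesgue (\<lambda>x. \<bar>c\<bar> powr p * (\<bar>u x\<bar> powr p * \<rho> x))"
    using assms u by (simp add: abs_in_Lp_iff)
  then show ?thesis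
    using assms u by (simp add: scaleR_abs_aefun abs_in_Lp_iff abs_mult powr_mult mult.assoc)
qed

lemma Lp_norm_scaleR: "Lp_norm p \<rho> (c *\<^sub>R U) = \<bar>c\<bar> * Lp_norm p \<rho> U"
proof -
  obtain u where u: "U = abs_aefun u" by (rule aefun_exhaust)
  have "(\<integral>x. \<bar>c * u x\<bar> powr p * \<rho> x \<partial>lebesgue) =
      (\<integral>x. \<bar>c\<bar> powr p * (\<bar>u x\<bar> powr p * \<rho> x) \<partial>lebesgue)"
    by (simp add: abs_mult powr_mult mult.assoc)
  also have "\<dots> = \<bar>c\<bar> powr p * (\<integral>x. \<bar>u x\<bar> powr p * \<rho> x \<partial>lebesgue)" by simp
  finally show ?thesis
    using p integral_nonneg[of u]
    by (simp add: u scaleR_abs_aefun Lp_norm_abs powr_mult powr_powr)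
qed

lemma Lp_uminus: "U \<in> Lp p \<rho> \<Longrightarrow> - U \<in> Lp p \<rho>"
  using Lp_scaleR[of U "-1"] by simp

lemma Lp_norm_uminus: "Lp_norm p \<rho> (- U) = Lp_norm p \<rho> U"
  using Lp_norm_scaleR[of "-1" U] by simp

lemma Lp_diff: "U \<in> Lp p \<rho> \<Longrightarrow> V \<in> Lp p \<rho> \<Longrightarrow> U - V \<in> Lp p \<rho>"
  using Lp_add[of U "- V"] Lp_uminus[of V] by simp

lemma Lp_norm_zero: "Lp_norm p \<rho> 0 = 0"
  using Lp_norm_scaleR[of 0 0] by simp

lemma Lp_norm_eq_0:
  assumes "U \<in> Lp p \<rho>" "Lp_norm p \<rho> U = 0" shows "U = 0"
proof -
  obtain u where u: "U = abs_aefun u" by (rule aefun_exhaust)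
  have i: "integrable lebesgue (\<lambda>x. \<bar>u x\<bar> powr p * \<rho> x)"
    using assms u by (simp add: abs_in_Lp_iff)
  have "(\<integral>x. \<bar>u x\<bar> powr p * \<rho> x \<partial>lebesgue) = 0"
    using assms u by (simp add: Lp_norm_abs)
  moreover have "AE x in lebesgue. 0 \<le> \<bar>u x\<bar> powr p * \<rho> x"
    using \<rho>_pos by (auto intro!: always_eventually simp: less_imp_le)
  ultimately have "AE x in lebesgue. \<bar>u x\<bar> powr p * \<rho> x = 0"
    using integral_nonneg_eq_0_iff_AE[OF i] by simp
  then have "AE x in lebesgue. u x = 0"
    by eventually_elim (use \<rho>_pos in \<open>auto simp: less_le\<close>)
  then show ?thesis by (simp add: u zero_abs_aefun aefun.abs_eq_iff)
qed

sublocale Metric_space "Lp p \<rho>" "Lp_dist p \<rho>"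
proof
  fix U V W :: "'a aefun"
  show "0 \<le> Lp_dist p \<rho> U V" by (simp add: Lp_dist_def Lp_norm_nonneg)
  show "Lp_dist p \<rho> U V = Lp_dist p \<rho> V U"
    using Lp_norm_uminus[of "U - V"] by (simp add: Lp_dist_def)
  assume UV: "U \<in> Lp p \<rho>" "V \<in> Lp p \<rho>"
  show "Lp_dist p \<rho> U V = 0 \<longleftrightarrow> U = V"
    using Lp_norm_eq_0[OF Lp_diff[OF UV]] Lp_norm_zero by (auto simp: Lp_dist_def)
  assume "W \<in> Lp p \<rho>"
  then show "Lp_dist p \<rho> U W \<le> Lp_dist p \<rho> U V + Lp_dist p \<rho> V W"
    using UV Lp_norm_triangle[of "U - V" "V - W"] Lp_diff by (simp add: Lp_dist_def)
qed

section \<open>Bounded functions in the weighted space\<close>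

lemma bounded_powr_integrable:
  assumes [measurable]: "u \<in> borel_measurable lebesgue" and C: "\<And>x. \<bar>u x\<bar> \<le> C"
  shows "integrable lebesgue (\<lambda>x. \<bar>u x\<bar> powr p * \<rho> x)"
proof (rule Bochner_Integration.integrable_bound)
  show "integrable lebesgue (\<lambda>x. C powr p * \<rho> x)" using \<rho>_integrable by simp
  show "AE x in lebesgue. norm (\<bar>u x\<bar> powr p * \<rho> x) \<le> norm (C powr p * \<rho> x)"
    using \<rho>_pos p C
    by (auto intro!: always_eventually mult_right_mono powr_mono2 simp: abs_mult less_imp_le)
qed measurable

lemma bounded_in_Lp:
  assumes u: "u \<in> borel_measurable lebesgue" and C: "\<And>x. \<bar>u x\<bar> \<le> C"
  shows "abs_aefun u \<in> Lp p \<rho>"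
  unfolding abs_in_Lp_iff
proof (intro conjI allI impI)
  show "integrable lebesgue (\<lambda>x. \<bar>u x\<bar> powr p * \<rho> x)"
    by (rule bounded_powr_integrable[OF assms])
  fix D :: "'a set" assume D: "compact D"
  then have "D \<in> lmeasurable" by (rule lmeasurable_compact)
  then have "integrable lebesgue (\<lambda>x. C * indicator D x)"
    by (intro integrable_mult_right integrable_real_indicator) (auto simp: fmeasurable_def)
  then show "set_integrable lebesgue D u"
    unfolding set_integrable_def
  proof (rule Bochner_Integration.integrable_bound)
    have [measurable]: "D \<in> sets lebesgue"
      using \<open>D \<in> lmeasurable\<close> by (rule fmeasurableD)
    show "(\<lambda>x. indicat_real D x *\<^sub>R u x) \<in> borel_measurable lebesgue"
      using u by measurable
    show "AE x in lebesgue. norm (indicat_real D x *\<^sub>R u x) \<le> norm (C * indicat_real D x)"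
      using C by (auto intro!: always_eventually simp: indicator_def intro: order_trans[OF _ abs_ge_self])
  qed
qed

lemma Lp_norm_bounded_le:
  assumes u: "u \<in> borel_measurable lebesgue" and C: "\<And>x. \<bar>u x\<bar> \<le> C"
  shows "Lp_norm p \<rho> (abs_aefun u) \<le> C"
proof -
  have C0: "0 \<le> C" using C[of 0] by linarith
  have "(\<integral>x. \<bar>u x\<bar> powr p * \<rho> x \<partial>lebesgue) \<le> (\<integral>x. C powr p * \<rho> x \<partial>lebesgue)"
    using \<rho>_integrable \<rho>_pos p C
    by (intro integral_mono bounded_powr_integrable[OF assms])
      (auto intro!: mult_right_mono powr_mono2 simp: less_imp_le)
  then show ?thesis using C0 \<rho>_int by (simp add: Lp_norm_abs_le_iff)
qed

text \<open>Constants are integrable against the weight, so \<open>C powr p * \<rho> x\<close> is a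
  dominating function on the whole space.\<close>

lemma Lp_norm_bounded_convergence:
  assumes [measurable]: "\<And>n::nat. u n \<in> borel_measurable lebesgue"
    and C: "\<And>n x. \<bar>u n x\<bar> \<le> C" and lim: "\<And>x. (\<lambda>n. u n x) \<longlonglongrightarrow> 0"
  shows "(\<lambda>n. Lp_norm p \<rho> (abs_aefun (u n))) \<longlonglongrightarrow> 0"
proof -
  have "(\<lambda>n. \<integral>x. \<bar>u n x\<bar> powr p * \<rho> x \<partial>lebesgue) \<longlonglongrightarrow> (\<integral>x. 0 \<partial>(lebesgue :: 'a measure))"
  proof (rule integral_dominated_convergence)
    show "integrable lebesgue (\<lambda>x. C powr p * \<rho> x)" using \<rho>_integrable by simp
    show "AE x in lebesgue. norm (\<bar>u n x\<bar> powr p * \<rho> x) \<le> C powr p * \<rho> x" for n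
      using \<rho>_pos p C
      by (auto intro!: always_eventually mult_right_mono powr_mono2 simp: abs_mult less_imp_le)
    have "(\<lambda>n. \<bar>u n x\<bar> powr p * \<rho> x) \<longlonglongrightarrow> 0 * \<rho> x" for x
      using p lim[of x]
      by (intro tendsto_mult tendsto_const tendsto_zero_powrI[where b = p] tendsto_rabs_zero) auto
    then show "AE x in lebesgue. (\<lambda>n. \<bar>u n x\<bar> powr p * \<rho> x) \<longlonglongrightarrow> 0" by simp
  qed measurable
  then show ?thesis
    unfolding Lp_norm_abs using p integral_nonneg
    by (intro tendsto_zero_powrI[where b = "1 / p"]) auto
qed

section \<open>Comparison of the norms of \<open>L^1(\<rho>)\<close> and
  \<open>L^p(\<rho>)\<close>\<close>

lemma weighted_L1: "weighted_Lp 1 \<rho>"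
  using \<rho>_integrable \<rho>_pos \<rho>_int by unfold_locales auto

text \<open>For \<open>c > 0\<close> and \<open>r \<ge> 0\<close> one has
  \<open>r \<le> c + c * (r / c) powr p\<close>: either \<open>r \<le> c\<close>, or the power
  dominates. Integrating against mass 1 with \<open>c\<close> close to the norm gives the factor
  2.\<close>

lemma Lp_subset_L1:
  assumes "U \<in> Lp p \<rho>"
  shows "U \<in> Lp 1 \<rho>" and "Lp_norm 1 \<rho> U \<le> 2 * Lp_norm p \<rho> U"
proof -
  interpret L1: weighted_Lp 1 \<rho> by (rule weighted_L1)
  obtain u where u: "U = abs_aefun u" by (rule aefun_exhaust)
  have [measurable]: "u \<in> borel_measurable lebesgue" using assms u Lp_measurable by simp
  have i: "integrable lebesgue (\<lambda>x. \<bar>u x\<bar> powr p * \<rho> x)"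
    using assms u by (simp add: abs_in_Lp_iff)
  have le: "\<bar>u x\<bar> powr 1 * \<rho> x \<le> c * \<rho> x + c / c powr p * (\<bar>u x\<bar> powr p * \<rho> x)"
    if "0 < c" for c x
  proof -
    have "\<bar>u x\<bar> / c \<le> 1 + (\<bar>u x\<bar> / c) powr p"
    proof (cases "\<bar>u x\<bar> / c \<le> 1")
      case False
      then have "(\<bar>u x\<bar> / c) powr 1 \<le> (\<bar>u x\<bar> / c) powr p"
        using p by (intro powr_mono) auto
      with False show ?thesis using that by simp
    qed (simp add: add_increasing2)
    then have "\<bar>u x\<bar> \<le> c + c / c powr p * \<bar>u x\<bar> powr p"
      using that by (simp add: powr_divide field_simps)
    from mult_right_mono[OF this less_imp_le[OF \<rho>_pos[of x]]] show ?thesis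
      by (simp add: algebra_simps)
  qed
  have i': "integrable lebesgue (\<lambda>x. c * \<rho> x + c / c powr p * (\<bar>u x\<bar> powr p * \<rho> x))" for c
    using i \<rho>_integrable by auto
  have i1: "integrable lebesgue (\<lambda>x. \<bar>u x\<bar> powr 1 * \<rho> x)"
    by (rule Bochner_Integration.integrable_bound[OF i'[of 1]])
      (use le[of 1] \<rho>_pos in \<open>auto intro!: always_eventually simp: abs_mult less_imp_le intro: order_trans[OF _ abs_ge_self]\<close>)
  with assms show "U \<in> Lp 1 \<rho>" by (simp add: u abs_in_Lp_iff L1.abs_in_Lp_iff)
  show "Lp_norm 1 \<rho> U \<le> 2 * Lp_norm p \<rho> U"
  proof (rule field_le_epsilon)
    fix e :: real assume "0 < e"
    \<comment> \<open>The summand \<open>e / 2\<close> keeps \<open>c\<close> positive if the norm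
      is 0; doubling \<open>c\<close> then costs exactly \<open>e\<close>.\<close>
    define c where "c = Lp_norm p \<rho> U + e / 2"
    have c: "0 < c" "Lp_norm p \<rho> U \<le> c"
      using \<open>0 < e\<close> Lp_norm_nonneg[of U] by (auto simp: c_def)
    have "(\<integral>x. \<bar>u x\<bar> powr 1 * \<rho> x \<partial>lebesgue) \<le>
        (\<integral>x. c * \<rho> x + c / c powr p * (\<bar>u x\<bar> powr p * \<rho> x) \<partial>lebesgue)"
      by (rule integral_mono[OF i1 i' le[OF c(1)]])
    also have "\<dots> = c + c / c powr p * (\<integral>x. \<bar>u x\<bar> powr p * \<rho> x \<partial>lebesgue)"
      using i \<rho>_integrable \<rho>_int by simp
    also have "\<dots> \<le> c + c / c powr p * c powr p"
      using c u by (intro add_left_mono mult_left_mono) (auto simp flip: Lp_norm_abs_le_iff)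
    also have "\<dots> = 2 * c" using c by simp
    finally show "Lp_norm 1 \<rho> U \<le> 2 * Lp_norm p \<rho> U + e"
      using L1.integral_nonneg[of u] by (simp add: u L1.Lp_norm_abs c_def)
  qed
qed

text \<open>Interpolation between \<open>L^1\<close> and the sup bound:
  \<open>\<bar>u\<bar> powr p\<close> is at most \<open>C powr (p - 1) * \<bar>u\<bar>\<close>. This
  is the way back from \<open>L^1\<close> estimates to the norm of the phase space.\<close>

lemma Lp_norm_le_L1_norm:
  assumes u: "u \<in> borel_measurable lebesgue" and C: "\<And>x. \<bar>u x\<bar> \<le> C"
  shows "Lp_norm p \<rho> (abs_aefun u) \<le> (C powr (p - 1) * Lp_norm 1 \<rho> (abs_aefun u)) powr (1 / p)"
proof -
  interpret L1: weighted_Lp 1 \<rho> by (rule weighted_L1)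
  have "\<bar>u x\<bar> powr p * \<rho> x \<le> C powr (p - 1) * (\<bar>u x\<bar> powr 1 * \<rho> x)" for x
  proof -
    have "\<bar>u x\<bar> powr p = \<bar>u x\<bar> powr (p - 1) * \<bar>u x\<bar> powr 1"
      using powr_add[of "\<bar>u x\<bar>" "p - 1" 1] by simp
    also have "\<dots> \<le> C powr (p - 1) * \<bar>u x\<bar> powr 1"
      using p C by (intro mult_right_mono powr_mono2) auto
    finally show ?thesis using mult_right_mono[OF _ less_imp_le[OF \<rho>_pos]] by (metis mult.assoc)
  qed
  then have "(\<integral>x. \<bar>u x\<bar> powr p * \<rho> x \<partial>lebesgue) \<le>
      (\<integral>x. C powr (p - 1) * (\<bar>u x\<bar> powr 1 * \<rho> x) \<partial>lebesgue)"
    by (intro integral_mono integrable_mult_right bounded_powr_integrable[OF assms]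
        L1.bounded_powr_integrable[OF assms])
  also have "\<dots> = C powr (p - 1) * Lp_norm 1 \<rho> (abs_aefun u)"
    using L1.integral_nonneg[of u] by (simp add: L1.Lp_norm_abs)
  finally show ?thesis
    unfolding Lp_norm_abs using p integral_nonneg by (intro powr_mono2) auto
qed

lemma mbounded_iff_norm:
  "mbounded C \<longleftrightarrow> C \<subseteq> Lp p \<rho> \<and> (\<exists>B. \<forall>U\<in>C. Lp_norm p \<rho> U \<le> B)"
proof
  assume C: "mbounded C"
  then have sub: "C \<subseteq> Lp p \<rho>" by (rule mbounded_subset_mspace)
  moreover have "\<exists>B. \<forall>U\<in>C. Lp_norm p \<rho> U \<le> B"
  proof (cases "C = {}")
    case False
    then obtain V B where V: "V \<in> Lp p \<rho>" "\<And>U. U \<in> C \<Longrightarrow> Lp_dist p \<rho> V U \<le> B"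
      using C unfolding mbounded by blast
    have "Lp_norm p \<rho> U \<le> B + Lp_norm p \<rho> V" if "U \<in> C" for U
      using Lp_norm_triangle[of "U - V" V] Lp_diff[of U V] V(1) V(2)[OF that] that sub commute[of V U]
      by (auto simp: Lp_dist_def)
    then show ?thesis by blast
  qed simp
  ultimately show "C \<subseteq> Lp p \<rho> \<and> (\<exists>B. \<forall>U\<in>C. Lp_norm p \<rho> U \<le> B)" ..
next
  assume C: "C \<subseteq> Lp p \<rho> \<and> (\<exists>B. \<forall>U\<in>C. Lp_norm p \<rho> U \<le> B)"
  then obtain B where "\<And>U. U \<in> C \<Longrightarrow> Lp_norm p \<rho> U \<le> B" by blast
  moreover have "0 \<in> Lp p \<rho>" by (simp add: zero_abs_aefun bounded_in_Lp[of _ 0])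
  ultimately show "mbounded C"
    using C unfolding mbounded
    by (auto simp: Lp_dist_def Lp_norm_uminus intro!: exI[of _ 0] exI[of _ B])
qed

end

section \<open>The neural field equation\<close>

text \<open>The factor 2 in the exponent absorbs the left-sided hypothesis, where
  \<open>1 / (1 - y) \<le> exp (2 * y)\<close> is used for small \<open>y\<close>.\<close>

lemma Dini_Gronwall:
  fixes \<phi> :: "real \<Rightarrow> real"
  assumes L: "0 \<le> L" and T: "0 \<le> T" and \<phi>: "\<And>t. 0 \<le> \<phi> t"
    and local: "\<And>t e. 0 \<le> t \<Longrightarrow> 0 < e \<Longrightarrow> \<exists>\<delta>>0. \<forall>s\<ge>0. \<bar>s - t\<bar> < \<delta> \<longrightarrow>
      (t \<le> s \<longrightarrow> \<phi> s \<le> \<phi> t + (s - t) * (L * \<phi> t + e)) \<and>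
      (s \<le> t \<longrightarrow> \<phi> t \<le> \<phi> s + (t - s) * (L * \<phi> t + e))"
  shows "\<phi> T \<le> exp (2 * L * T) * \<phi> 0"
proof -
  \<comment> \<open>With the expected growth divided out, it remains to show that
    \<open>\<psi>\<close> increases with slope at most \<open>e\<close>, for every positive
    \<open>e\<close>.\<close>
  define \<psi> where "\<psi> t = exp (- (2 * L * t)) * \<phi> t" for t
  have step: "\<psi> T \<le> \<psi> 0 + e * T" if e: "0 < e" for e
  proof -
    have "0 \<le> (0::real) \<longrightarrow> \<psi> T \<le> \<psi> 0 + e * (T - 0)"
      using T
    \<comment> \<open>The estimate is additive over adjacent intervals, so compactness of the
      interval reduces it to short intervals around each point, where the local hypothesis applies
      on both sides.\<close>
    proof (induction rule: Bolzano[where P = "\<lambda>a b. 0 \<le> a \<longrightarrow> \<psi> b \<le> \<psi> a + e * (b - a)"])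
      case (trans a b c)
      then show ?case by (auto simp: algebra_simps)
    next
      case (local x)
      obtain \<delta> where \<delta>: "\<delta> > 0" and
        right: "\<And>s. 0 \<le> s \<Longrightarrow> \<bar>s - x\<bar> < \<delta> \<Longrightarrow> x \<le> s \<Longrightarrow> \<phi> s \<le> \<phi> x + (s - x) * (L * \<phi> x + e)" and
        left: "\<And>s. 0 \<le> s \<Longrightarrow> \<bar>s - x\<bar> < \<delta> \<Longrightarrow> s \<le> x \<Longrightarrow> \<phi> x \<le> \<phi> s + (x - s) * (L * \<phi> x + e)"
        using assms(4)[OF local(1) e] by blast
      \<comment> \<open>The second entry keeps \<open>L\<close> times the length of the interval at
        most \<open>1 / 2\<close>, as the left-sided estimate requires.\<close>
      define d where "d = min \<delta> (1 / (2 * L + 2))"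
      have d: "0 < d" "d \<le> \<delta>" using \<delta> L by (auto simp: d_def)
      have Ld: "L * \<eta> \<le> 1 / 2" if "0 \<le> \<eta>" "\<eta> \<le> d" for \<eta>
      proof -
        have "L * \<eta> \<le> L * (1 / (2 * L + 2))"
          using that L by (intro mult_left_mono) (auto simp: d_def)
        also have "\<dots> \<le> 1 / 2" using L by (simp add: field_simps)
        finally show ?thesis .
      qed
      have main: "\<psi> b \<le> \<psi> a + e * (b - a)" if ab: "a \<le> x" "x \<le> b" "b - a < d" "0 \<le> a" for a b
      proof -
        have "\<psi> x \<le> \<psi> a + e * (x - a)"
        proof -
          define y where "y = L * (x - a)"
          have y: "0 \<le> y" "y \<le> 1 / 2" using Ld[of "x - a"] ab L by (auto simp: y_def)
          have "\<phi> x * (1 - y) \<le> \<phi> a + (x - a) * e"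
            using left[of a] ab d by (simp add: y_def algebra_simps)
          moreover have "exp (- (2 * y)) \<le> 1 - y"
          proof -
            have "2 * (y * y) \<le> y" using y mult_right_mono[of y "1 / 2" y] by simp
            then have "1 \<le> (1 - y) * (1 + 2 * y)" by (simp add: algebra_simps)
            also have "\<dots> \<le> (1 - y) * exp (2 * y)"
              using y by (intro mult_left_mono) auto
            finally show ?thesis by (simp add: exp_minus field_simps)
          qed
          ultimately have "\<phi> x * exp (- (2 * y)) \<le> \<phi> a + (x - a) * e"
            using mult_left_mono[OF _ \<phi>] order_trans by blast
          then have "exp (- (2 * L * a)) * (\<phi> x * exp (- (2 * y))) \<le> exp (- (2 * L * a)) * (\<phi> a + (x - a) * e)"
            by (intro mult_left_mono) auto
          also have "exp (- (2 * L * a)) * (\<phi> x * exp (- (2 * y))) = \<psi> x"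
          proof -
            have "exp (- (2 * L * x)) = exp (- (2 * L * a)) * exp (- (2 * y))"
              unfolding exp_add[symmetric] by (simp add: y_def algebra_simps)
            then show ?thesis unfolding \<psi>_def by simp
          qed
          also have "exp (- (2 * L * a)) * (\<phi> a + (x - a) * e) \<le> \<psi> a + e * (x - a)"
          proof -
            have "exp (- (2 * L * a)) * ((x - a) * e) \<le> 1 * ((x - a) * e)"
              using ab e L by (intro mult_right_mono) auto
            then show ?thesis by (simp add: \<psi>_def algebra_simps)
          qed
          finally show ?thesis .
        qed
        moreover have "\<psi> b \<le> \<psi> x + e * (b - x)"
        proof -
          define y where "y = L * (b - x)"
          have y: "0 \<le> y" using ab L by (auto simp: y_def)
          have "\<phi> b \<le> \<phi> x * (1 + y) + (b - x) * e"
            using right[of b] ab d local(1) by (simp add: y_def algebra_simps)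
          also have "\<phi> x * (1 + y) \<le> \<phi> x * exp (2 * y)"
            using y \<phi> exp_ge_add_one_self[of "2 * y"] by (intro mult_left_mono) linarith+
          finally have "exp (- (2 * L * b)) * \<phi> b \<le> exp (- (2 * L * b)) * (\<phi> x * exp (2 * y) + (b - x) * e)"
            by (intro mult_left_mono) auto
          also have "\<dots> = \<psi> x + exp (- (2 * L * b)) * ((b - x) * e)"
          proof -
            have "exp (- (2 * L * x)) = exp (- (2 * L * b)) * exp (2 * y)"
              unfolding exp_add[symmetric] by (simp add: y_def algebra_simps)
            then show ?thesis unfolding \<psi>_def by (simp add: distrib_left)
          qed
          also have "exp (- (2 * L * b)) * ((b - x) * e) \<le> 1 * ((b - x) * e)"
            using ab e L by (intro mult_right_mono) auto
          finally show ?thesis by (simp add: \<psi>_def algebra_simps)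
        qed
        ultimately show ?thesis by (simp add: algebra_simps)
      qed
      show ?case
        using d(1) main by (intro exI[of _ d] conjI allI impI) (assumption | elim conjE | rule main)+
    qed
    then show ?thesis by simp
  qed
  have "\<psi> T \<le> \<psi> 0"
  proof (rule field_le_epsilon)
    fix e :: real assume "0 < e"
    then have "\<psi> T \<le> \<psi> 0 + e / (T + 1) * T" using T by (intro step) auto
    also have "e / (T + 1) * T \<le> e" using T \<open>0 < e\<close> by (simp add: field_simps)
    finally show "\<psi> T \<le> \<psi> 0 + e" by simp
  qed
  then have "exp (2 * L * T) * \<psi> T \<le> exp (2 * L * T) * \<psi> 0" by (intro mult_left_mono) auto
  then show ?thesis by (simp add: \<psi>_def mult.assoc[symmetric] flip: exp_add)
qed

text \<open>\<open>M\<close> is a Lipschitz constant of \<open>J\<close>, to be supplied by the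
  bounded partial derivatives; \<open>\<rho>_K\<close> is the pointwise form of the condition on
  suprema over unit balls.\<close>

locale neural_field = weighted_Lp p \<rho>
  for p :: real and \<rho> :: "'a::euclidean_space \<Rightarrow> real" +
  fixes J :: "'a \<Rightarrow> real" and f :: "real \<Rightarrow> real" and h a k K M :: real
  assumes J_lipschitz: "\<And>x y. \<bar>J x - J y\<bar> \<le> M * norm (x - y)"
    and J_nonneg [simp]: "\<And>x. 0 \<le> J x"
    and J_even: "\<And>x. J (- x) = J x"
    and J_supp: "\<And>x. 1 < norm x \<Longrightarrow> J x = 0"
    and f_nonneg [simp]: "\<And>x. 0 \<le> f x"
    and f_le: "\<And>x. f x \<le> a"
    and f_mono: "mono f"
    and f_lipschitz: "\<And>x y. \<bar>f x - f y\<bar> \<le> k * \<bar>x - y\<bar>"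
    and h_nonneg: "0 \<le> h"
    and \<rho>_K: "\<And>x y. norm (x - y) \<le> 1 \<Longrightarrow> \<rho> x \<le> K * \<rho> y"
begin

section \<open>Kernel bounds and the smoothing effect of convolution\<close>

lemma a_nonneg: "0 \<le> a"
  using f_nonneg f_le order_trans by blast

lemma k_nonneg: "0 \<le> k"
  using f_lipschitz[of 1 0] by simp

lemma M_nonneg: "0 \<le> M"
proof -
  obtain b :: 'a where "b \<in> Basis" using nonempty_Basis by blast
  then show ?thesis using J_lipschitz[of b 0] by simp
qed

lemma K_ge_1: "1 \<le> K"
  using \<rho>_K[of 0 0] \<rho>_pos[of 0] by simp

text \<open>A translation by a vector of length 3 moves any point of the unit ball out of the
  support, so the Lipschitz condition alone bounds \<open>J\<close>.\<close>

lemma J_le: "J x \<le> 3 * M"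
proof (cases "norm x \<le> 1")
  case True
  obtain b :: 'a where "b \<in> Basis" using nonempty_Basis by blast
  then have b: "norm b = 1" by simp
  have "norm (3 *\<^sub>R b) \<le> norm (x + 3 *\<^sub>R b) + norm x"
    using norm_triangle_ineq4[of "x + 3 *\<^sub>R b" x] by simp
  then have "J (x + 3 *\<^sub>R b) = 0" using True b by (intro J_supp) simp
  then show ?thesis using J_lipschitz[of x "x + 3 *\<^sub>R b"] b by simp
next
  case False
  then show ?thesis using J_supp[of x] M_nonneg by simp
qed

lemma J_continuous: "continuous_on UNIV J"
  by (rule lipschitz_on_continuous_on[of M]) 
    (use J_lipschitz M_nonneg in \<open>auto simp: lipschitz_on_def dist_norm\<close>)

lemma J_borel [measurable]: "J \<in> borel_measurable borel"
  by (rule borel_measurable_continuous_onI[OF J_continuous])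

lemma f_continuous: "continuous_on UNIV f"
  by (rule lipschitz_on_continuous_on[of k])
    (use f_lipschitz k_nonneg in \<open>auto simp: lipschitz_on_def dist_norm\<close>)

lemma f_borel [measurable]: "f \<in> borel_measurable borel"
  by (rule borel_measurable_continuous_onI[OF f_continuous])

lemma J_shift: "J (x - y) = J (y - x)"
  using J_even[of "x - y"] by simp

lemma J_le_indicator: "J (x - y) \<le> 3 * M * indicator (cball x 1) y"
  using J_le[of "x - y"] J_supp[of "x - y"] M_nonneg
  by (auto simp: indicator_def dist_norm not_le)

lemma J_shift_measurable [measurable]: "(\<lambda>y. J (x - y)) \<in> borel_measurable lebesgue"
  by (rule measurable_completion) measurable

lemma ball_indicator_integrable: "integrable lebesgue (\<lambda>y. c * indicator (cball (x::'a) 1) y :: real)"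
  by (intro integrable_mult_right integrable_real_indicator) (auto simp: emeasure_cball)

lemma J_shift_integrable: "integrable lebesgue (\<lambda>y. J (x - y))"
  by (rule Bochner_Integration.integrable_bound[OF ball_indicator_integrable[of "3 * M" x]])
    (use J_le_indicator in \<open>auto intro!: always_eventually intro: order_trans[OF _ abs_ge_self]\<close>)

definition mass :: real where "mass = (\<integral>x. J x \<partial>lebesgue)"

lemma J_shift_nn_integral: "(\<integral>\<^sup>+ x. J (x - y) \<partial>lborel) = (\<integral>\<^sup>+ x. J x \<partial>lborel)"
proof -
  have "(\<integral>\<^sup>+ x. J x \<partial>lborel) = (\<integral>\<^sup>+ x. J x \<partial>(distr lborel borel ((+) (- y))))"
    by (simp add: lborel_distr_plus)
  also have "\<dots> = (\<integral>\<^sup>+ x. J (- y + x) \<partial>lborel)" by (rule nn_integral_distr) simp_all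
  finally show ?thesis by simp
qed

lemma J_nn_integral: "(\<integral>\<^sup>+ x. J x \<partial>lborel) = ennreal mass"
  using nn_integral_eq_integral[OF J_shift_integrable[of 0]]
  by (simp add: J_even mass_def nn_integral_completion)

lemma mass_nonneg: "0 \<le> mass"
  unfolding mass_def by (intro integral_nonneg_AE always_eventually) simp

text \<open>The integration variable enters with a minus sign; evenness of \<open>J\<close> turns
  the reflection into a translation.\<close>

lemma J_shift_integral: "(\<integral>y. J (x - y) \<partial>lebesgue) = mass"
proof -
  have "ennreal (\<integral>y. J (x - y) \<partial>lebesgue) = (\<integral>\<^sup>+ y. J (y - x) \<partial>lborel)"
    using nn_integral_eq_integral[OF J_shift_integrable[of x]]
    by (simp add: nn_integral_completion J_shift)
  also have "\<dots> = ennreal mass" by (simp add: J_shift_nn_integral J_nn_integral)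
  finally show ?thesis
    by (subst (asm) ennreal_inj) (auto simp: mass_nonneg intro!: integral_nonneg_AE always_eventually)
qed

definition conv :: "('a \<Rightarrow> real) \<Rightarrow> 'a \<Rightarrow> real"
  where "conv v x = (\<integral>y. J (x - y) * f (v y) \<partial>lebesgue)"

lemma J_f_le: "J x * f r \<le> a * J x"
  using mult_left_mono[OF f_le J_nonneg] by (simp add: mult.commute)

lemma conv_integrable:
  assumes [measurable]: "v \<in> borel_measurable lebesgue"
  shows "integrable lebesgue (\<lambda>y. J (x - y) * f (v y))"
proof (rule Bochner_Integration.integrable_bound)
  show "integrable lebesgue (\<lambda>y. a * J (x - y))" using J_shift_integrable by simp
  show "AE y in lebesgue. norm (J (x - y) * f (v y)) \<le> norm (a * J (x - y))"
    using J_f_le a_nonneg by (auto intro!: always_eventually simp: abs_mult)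
qed measurable

lemma conv_nonneg: "0 \<le> conv v x"
  unfolding conv_def by (intro integral_nonneg_AE always_eventually) simp

lemma conv_le:
  assumes v: "v \<in> borel_measurable lebesgue"
  shows "conv v x \<le> a * mass"
proof -
  have "conv v x \<le> (\<integral>y. a * J (x - y) \<partial>lebesgue)"
    unfolding conv_def using J_shift_integrable f_le
    by (intro integral_mono conv_integrable v) (auto simp: mult.commute intro!: mult_right_mono)
  then show ?thesis by (simp add: J_shift_integral)
qed

lemma conv_mono:
  assumes "v \<in> borel_measurable lebesgue" "w \<in> borel_measurable lebesgue" "\<And>y. v y \<le> w y"
  shows "conv v x \<le> conv w x"
  unfolding conv_def using assms f_mono
  by (intro integral_mono conv_integrable mult_left_mono) (auto dest: monoD)

text \<open>The integrand of a difference of convolutions is at most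
  \<open>a * M * norm (x - x')\<close> and lives on two unit balls, whence the factor 2 and the
  volume.\<close>

definition \<Lambda> :: real where "\<Lambda> = 2 * a * M * measure lebesgue (cball (0::'a) 1)"

text \<open>Regularity comes from \<open>J\<close> and the bound from \<open>f\<close>, so the
  constant is the same for every measurable \<open>v\<close>. All compactness of the flow rests on
  this uniformity.\<close>

lemma conv_lipschitz:
  assumes [measurable]: "v \<in> borel_measurable lebesgue"
  shows "\<bar>conv v x - conv v x'\<bar> \<le> \<Lambda> * norm (x - x')"
proof -
  define c where "c = a * M * norm (x - x')"
  have c: "0 \<le> c" using a_nonneg M_nonneg by (simp add: c_def)
  have i: "integrable lebesgue (\<lambda>y. c * indicator (cball x 1) y + c * indicator (cball x' 1) y)"
    by (intro Bochner_Integration.integrable_add ball_indicator_integrable)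
  have le: "\<bar>J (x - y) * f (v y) - J (x' - y) * f (v y)\<bar>
      \<le> c * indicator (cball x 1) y + c * indicator (cball x' 1) y" for y
  proof (cases "y \<in> cball x 1 \<or> y \<in> cball x' 1")
    case True
    have "\<bar>J (x - y) * f (v y) - J (x' - y) * f (v y)\<bar> = \<bar>J (x - y) - J (x' - y)\<bar> * f (v y)"
      by (simp add: abs_mult flip: left_diff_distrib)
    also have "\<dots> \<le> (M * norm (x - x')) * a"
      using J_lipschitz[of "x - y" "x' - y"] f_le by (intro mult_mono) (auto simp: M_nonneg)
    also have "\<dots> \<le> c * indicator (cball x 1) y + c * indicator (cball x' 1) y"
      using True c by (auto simp: c_def indicator_def mult_ac)
    finally show ?thesis .
  next
    case False
    then have "J (x - y) = 0" "J (x' - y) = 0" by (auto intro!: J_supp simp: dist_norm)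
    then show ?thesis using c by (simp add: indicator_def)
  qed
  have "\<bar>conv v x - conv v x'\<bar> = \<bar>\<integral>y. J (x - y) * f (v y) - J (x' - y) * f (v y) \<partial>lebesgue\<bar>"
    unfolding conv_def by (simp add: conv_integrable)
  also have "\<dots> \<le> (\<integral>y. \<bar>J (x - y) * f (v y) - J (x' - y) * f (v y)\<bar> \<partial>lebesgue)"
    by (rule integral_abs_bound)
  also have "\<dots> \<le> (\<integral>y. c * indicator (cball x 1) y + c * indicator (cball x' 1) y \<partial>lebesgue)"
    by (intro integral_mono i le integrable_abs Bochner_Integration.integrable_diff conv_integrable) measurable
  also have "\<dots> = c * measure lebesgue (cball x 1) + c * measure lebesgue (cball x' 1)"
    using ball_indicator_integrable[of c x] ball_indicator_integrable[of c x'] by simp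
  also have "\<dots> = \<Lambda> * norm (x - x')"
    by (simp add: content_cball \<Lambda>_def c_def)
  finally show ?thesis .
qed

lemma \<Lambda>_nonneg: "0 \<le> \<Lambda>"
  by (simp add: \<Lambda>_def a_nonneg M_nonneg)

lemma conv_continuous:
  assumes "v \<in> borel_measurable lebesgue"
  shows "continuous_on UNIV (conv v)"
  by (rule lipschitz_on_continuous_on[of \<Lambda>])
    (use conv_lipschitz[OF assms] \<Lambda>_nonneg in \<open>auto simp: lipschitz_on_def dist_norm\<close>)

lemma conv_borel:
  assumes "v \<in> borel_measurable lebesgue"
  shows "conv v \<in> borel_measurable borel"
  by (rule borel_measurable_continuous_onI[OF conv_continuous[OF assms]])

lemma conv_tendsto:
  assumes v: "\<And>n::nat. v n \<in> borel_measurable lebesgue" "w \<in> borel_measurable lebesgue"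
    and lim: "\<And>y. (\<lambda>n. v n y) \<longlonglongrightarrow> w y"
  shows "(\<lambda>n. conv (v n) x) \<longlonglongrightarrow> conv w x"
  unfolding conv_def
proof (rule integral_dominated_convergence)
  show "integrable lebesgue (\<lambda>y. a * J (x - y))" using J_shift_integrable by simp
  show "AE y in lebesgue. norm (J (x - y) * f (v n y)) \<le> a * J (x - y)" for n
    using J_f_le by (auto intro!: always_eventually simp: abs_mult)
  show "AE y in lebesgue. (\<lambda>n. J (x - y) * f (v n y)) \<longlonglongrightarrow> J (x - y) * f (w y)"
    using f_continuous lim
    by (intro always_eventually allI tendsto_mult tendsto_const continuous_on_tendsto_compose[of UNIV f]) auto
qed (use v in measurable)

section \<open>Lipschitz estimate of the right-hand side in \<open>L^1(\<rho>)\<close>\<close>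

lemma neural_rhs_abs:
  "neural_rhs J f h (abs_aefun u) = abs_aefun (\<lambda>x. - u x + conv u x + h)"
  by (simp add: neural_rhs_def uminus_aefun.abs_eq convol_ae.abs_eq comp_ae.abs_eq
      const_ae_def plus_abs_aefun conv_def)

lemma conv_diff_in_Lp:
  assumes "u \<in> borel_measurable lebesgue" "v \<in> borel_measurable lebesgue"
  shows "abs_aefun (\<lambda>x. conv u x - conv v x) \<in> Lp p \<rho>"
proof (rule bounded_in_Lp)
  show "(\<lambda>x. conv u x - conv v x) \<in> borel_measurable lebesgue"
    using conv_borel[OF assms(1)] conv_borel[OF assms(2)] by (intro measurable_completion) simp
  show "\<bar>conv u x - conv v x\<bar> \<le> a * mass" for x
    using conv_nonneg[of u x] conv_nonneg[of v x] conv_le[OF assms(1), of x] conv_le[OF assms(2), of x]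
    by linarith
qed

lemma neural_rhs_in_Lp:
  assumes "U \<in> Lp p \<rho>" shows "neural_rhs J f h U \<in> Lp p \<rho>"
proof -
  obtain u where u: "U = abs_aefun u" by (rule aefun_exhaust)
  have m: "u \<in> borel_measurable lebesgue" using assms u Lp_measurable by simp
  have "abs_aefun (\<lambda>x. conv u x + h) \<in> Lp p \<rho>"
  proof (rule bounded_in_Lp)
    show "(\<lambda>x. conv u x + h) \<in> borel_measurable lebesgue"
      using conv_borel[OF m] by (intro measurable_completion) simp
    show "\<bar>conv u x + h\<bar> \<le> a * mass + h" for x
      using conv_nonneg[of u x] conv_le[OF m, of x] h_nonneg by linarith
  qed
  from Lp_add[OF Lp_uminus[OF assms] this] show ?thesis
    unfolding u neural_rhs_abs uminus_aefun.abs_eq plus_abs_aefun add.assoc .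
qed

text \<open>After exchanging the integrals, the one over \<open>x\<close> comes first:
  \<open>J (x - y)\<close> vanishes unless the points are within distance 1, and there
  \<open>\<rho> x \<le> K * \<rho> y\<close>. So the inner integral is at most
  \<open>K * mass * \<rho> y\<close>.\<close>

lemma conv_L1_lipschitz:
  assumes U: "abs_aefun u \<in> Lp p \<rho>" and V: "abs_aefun v \<in> Lp p \<rho>"
    and [measurable]: "u \<in> borel_measurable borel" "v \<in> borel_measurable borel"
  shows "Lp_norm 1 \<rho> (abs_aefun (\<lambda>x. conv u x - conv v x)) \<le>
    k * K * mass * Lp_norm 1 \<rho> (abs_aefun (\<lambda>x. u x - v x))"
proof -
  interpret L1: weighted_Lp 1 \<rho> by (rule weighted_L1)
  have [measurable]: "u \<in> borel_measurable lebesgue" "v \<in> borel_measurable lebesgue"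
    using Lp_measurable U V by auto
  have norm_eq: "ennreal (Lp_norm 1 \<rho> (abs_aefun g)) = (\<integral>\<^sup>+x. ennreal \<bar>g x\<bar> * ennreal (\<rho> x) \<partial>lborel)"
    if "abs_aefun g \<in> Lp p \<rho>" for g
  proof -
    have "integrable lebesgue (\<lambda>x. \<bar>g x\<bar> powr 1 * \<rho> x)"
      using Lp_subset_L1(1)[OF that] by (simp add: L1.abs_in_Lp_iff)
    then show ?thesis
      using nn_integral_eq_integral[of lebesgue "\<lambda>x. \<bar>g x\<bar> * \<rho> x"] L1.integral_nonneg[of g]
      by (simp add: L1.Lp_norm_abs nn_integral_completion ennreal_mult)
  qed
  \<comment> \<open>The weight is only Lebesgue measurable, while the integrals are exchanged over
    Borel measures; a Borel version stands in for it.\<close>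
  obtain \<rho>' where [measurable]: "\<rho>' \<in> borel_measurable lborel" and \<rho>': "AE x in lborel. \<rho> x = \<rho>' x"
    using completion_ex_borel_measurable_real[OF \<rho>_measurable] by blast
  then have \<rho>'_eq: "AE x in lborel. \<rho>' x = \<rho> x" by (auto elim: eventually_mono)
  have uv: "abs_aefun (\<lambda>x. u x - v x) \<in> Lp p \<rho>"
    using Lp_diff[OF U V] by (simp add: minus_abs_aefun)
  have pt: "ennreal \<bar>conv u x - conv v x\<bar> \<le> (\<integral>\<^sup>+y. k * (J (x - y) * \<bar>u y - v y\<bar>) \<partial>lborel)" for x
  proof -
    have "ennreal \<bar>conv u x - conv v x\<bar> =
        ennreal (norm (\<integral>y. J (x - y) * f (u y) - J (x - y) * f (v y) \<partial>lebesgue))"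
      unfolding conv_def by (simp add: conv_integrable)
    also have "\<dots> \<le> (\<integral>\<^sup>+y. norm (J (x - y) * f (u y) - J (x - y) * f (v y)) \<partial>lebesgue)"
      by (intro integral_norm_bound_ennreal Bochner_Integration.integrable_diff conv_integrable) measurable
    also have "\<dots> \<le> (\<integral>\<^sup>+y. k * (J (x - y) * \<bar>u y - v y\<bar>) \<partial>lebesgue)"
    proof (intro nn_integral_mono ennreal_leI)
      fix y
      have "norm (J (x - y) * f (u y) - J (x - y) * f (v y)) = J (x - y) * \<bar>f (u y) - f (v y)\<bar>"
        by (simp add: abs_mult flip: right_diff_distrib)
      also have "\<dots> \<le> J (x - y) * (k * \<bar>u y - v y\<bar>)"
        by (intro mult_left_mono f_lipschitz) simp
      finally show "norm (J (x - y) * f (u y) - J (x - y) * f (v y)) \<le> k * (J (x - y) * \<bar>u y - v y\<bar>)"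
        by (simp add: mult_ac)
    qed
    finally show ?thesis by (simp add: nn_integral_completion)
  qed
  have inner: "(\<integral>\<^sup>+x. ennreal (J (x - y)) * ennreal (\<rho>' x) \<partial>lborel) \<le> ennreal (K * mass * \<rho> y)" for y
  proof -
    have "(\<integral>\<^sup>+x. ennreal (J (x - y)) * ennreal (\<rho>' x) \<partial>lborel) =
        (\<integral>\<^sup>+x. ennreal (J (x - y)) * ennreal (\<rho> x) \<partial>lborel)"
      by (rule nn_integral_cong_AE) (use \<rho>' in eventually_elim, simp)
    also have "\<dots> \<le> (\<integral>\<^sup>+x. ennreal (K * \<rho> y) * ennreal (J (x - y)) \<partial>lborel)"
    proof (rule nn_integral_mono)
      fix x
      show "ennreal (J (x - y)) * ennreal (\<rho> x) \<le> ennreal (K * \<rho> y) * ennreal (J (x - y))"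
      proof (cases "norm (x - y) \<le> 1")
        case True
        then show ?thesis
          by (subst mult.commute) (intro mult_right_mono ennreal_leI \<rho>_K, auto)
      next
        case False
        then show ?thesis using J_supp[of "x - y"] by simp
      qed
    qed
    also have "\<dots> = ennreal (K * \<rho> y) * ennreal mass"
      by (subst nn_integral_cmult) (auto simp: J_shift_nn_integral J_nn_integral)
    also have "\<dots> = ennreal (K * mass * \<rho> y)"
      using K_ge_1 mass_nonneg by (simp add: mult_ac flip: ennreal_mult)
    finally show ?thesis .
  qed
  have "ennreal (Lp_norm 1 \<rho> (abs_aefun (\<lambda>x. conv u x - conv v x))) =
      (\<integral>\<^sup>+x. ennreal \<bar>conv u x - conv v x\<bar> * ennreal (\<rho> x) \<partial>lborel)"
    by (intro norm_eq conv_diff_in_Lp) measurable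
  also have "\<dots> \<le> (\<integral>\<^sup>+x. (\<integral>\<^sup>+y. k * (J (x - y) * \<bar>u y - v y\<bar>) \<partial>lborel) * ennreal (\<rho>' x) \<partial>lborel)"
    using \<rho>' by (intro nn_integral_mono_AE, eventually_elim) (auto intro!: mult_right_mono pt)
  also have "\<dots> = (\<integral>\<^sup>+x. (\<integral>\<^sup>+y. k * (J (x - y) * \<bar>u y - v y\<bar>) * ennreal (\<rho>' x) \<partial>lborel) \<partial>lborel)"
    by (subst nn_integral_multc) auto
  also have "\<dots> = (\<integral>\<^sup>+y. (\<integral>\<^sup>+x. k * (J (x - y) * \<bar>u y - v y\<bar>) * ennreal (\<rho>' x) \<partial>lborel) \<partial>lborel)"
    by (rule lborel_pair.Fubini') measurable
  also have "\<dots> = (\<integral>\<^sup>+y. ennreal (k * \<bar>u y - v y\<bar>) *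
      (\<integral>\<^sup>+x. ennreal (J (x - y)) * ennreal (\<rho>' x) \<partial>lborel) \<partial>lborel)"
    using k_nonneg
    by (intro nn_integral_cong) (subst nn_integral_cmult[symmetric],
        auto simp: ennreal_mult mult_ac intro!: nn_integral_cong)
  also have "\<dots> \<le> (\<integral>\<^sup>+y. ennreal (k * \<bar>u y - v y\<bar>) * ennreal (K * mass * \<rho> y) \<partial>lborel)"
    by (intro nn_integral_mono mult_left_mono inner) simp
  also have "\<dots> = (\<integral>\<^sup>+y. ennreal (k * K * mass) * (ennreal \<bar>u y - v y\<bar> * ennreal (\<rho>' y)) \<partial>lborel)"
    by (rule nn_integral_cong_AE, use \<rho>'_eq in eventually_elim)
      (use k_nonneg K_ge_1 mass_nonneg in \<open>simp add: mult_ac flip: ennreal_mult\<close>)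
  also have "\<dots> = ennreal (k * K * mass) * (\<integral>\<^sup>+y. ennreal \<bar>u y - v y\<bar> * ennreal (\<rho>' y) \<partial>lborel)"
    by (rule nn_integral_cmult) measurable
  also have "(\<integral>\<^sup>+y. ennreal \<bar>u y - v y\<bar> * ennreal (\<rho>' y) \<partial>lborel) =
      (\<integral>\<^sup>+y. ennreal \<bar>u y - v y\<bar> * ennreal (\<rho> y) \<partial>lborel)"
    by (rule nn_integral_cong_AE) (use \<rho>' in eventually_elim, simp)
  also have "\<dots> = ennreal (Lp_norm 1 \<rho> (abs_aefun (\<lambda>x. u x - v x)))"
    by (rule norm_eq[OF uv, symmetric])
  finally show ?thesis
    using k_nonneg K_ge_1 mass_nonneg L1.Lp_norm_nonneg by (simp flip: ennreal_mult)
qed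

definition Lip :: real where "Lip = 1 + k * K * mass"

lemma Lip_nonneg: "0 \<le> Lip"
  using k_nonneg K_ge_1 mass_nonneg by (simp add: Lip_def)

lemma neural_rhs_L1_lipschitz:
  assumes U: "U \<in> Lp p \<rho>" and V: "V \<in> Lp p \<rho>"
  shows "Lp_norm 1 \<rho> (neural_rhs J f h U - neural_rhs J f h V) \<le> Lip * Lp_norm 1 \<rho> (U - V)"
proof -
  interpret L1: weighted_Lp 1 \<rho> by (rule weighted_L1)
  obtain u where u: "U = abs_aefun u" "u \<in> borel_measurable borel" using Lp_borel_cases[OF U] .
  obtain v where v: "V = abs_aefun v" "v \<in> borel_measurable borel" using Lp_borel_cases[OF V] .
  let ?D = "abs_aefun (\<lambda>x. conv u x - conv v x)"
  have "neural_rhs J f h U - neural_rhs J f h V = - (U - V) + ?D"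
    by (simp add: u v neural_rhs_abs minus_abs_aefun plus_abs_aefun uminus_aefun.abs_eq algebra_simps)
  moreover have "- (U - V) \<in> Lp 1 \<rho>"
    using Lp_subset_L1(1)[OF Lp_uminus[OF Lp_diff[OF U V]]] .
  moreover have "?D \<in> Lp 1 \<rho>"
    using U V u v by (intro Lp_subset_L1(1) conv_diff_in_Lp Lp_measurable) auto
  ultimately have "Lp_norm 1 \<rho> (neural_rhs J f h U - neural_rhs J f h V) \<le>
      Lp_norm 1 \<rho> (- (U - V)) + Lp_norm 1 \<rho> ?D"
    using L1.Lp_norm_triangle by simp
  also have "Lp_norm 1 \<rho> (- (U - V)) = Lp_norm 1 \<rho> (U - V)" by (rule L1.Lp_norm_uminus)
  also have "Lp_norm 1 \<rho> ?D \<le> k * K * mass * Lp_norm 1 \<rho> (U - V)"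
    using conv_L1_lipschitz[of u v] U V u v by (simp add: minus_abs_aefun)
  finally show ?thesis by (simp add: Lip_def algebra_simps)
qed

section \<open>A priori bounds for the integrated equation\<close>

definition R0 :: real where "R0 = a * mass + h"

lemma R0_nonneg: "0 \<le> R0"
  using a_nonneg mass_nonneg h_nonneg by (simp add: R0_def)

text \<open>The bounds are time integrals of \<open>exp r * R0\<close> and
  \<open>exp r * \<Lambda> * norm (x - y)\<close>, so they do not refer to the initial state. They
  are preserved by \<open>Picard\<close> and by pointwise limits; the space estimate makes
  \<open>W t\<close> Borel, the time estimate makes the integrand of \<open>Picard\<close>
  continuous.\<close>

definition admissible :: "(real \<Rightarrow> 'a \<Rightarrow> real) \<Rightarrow> bool" where
  "admissible W \<longleftrightarrow> (\<forall>t\<ge>0. \<forall>x. 0 \<le> W t x \<and> W t x \<le> (exp t - 1) * R0) \<and>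
    (\<forall>t\<ge>0. \<forall>x y. \<bar>W t x - W t y\<bar> \<le> (exp t - 1) * \<Lambda> * norm (x - y)) \<and>
    (\<forall>s\<ge>0. \<forall>t\<ge>s. \<forall>x. \<bar>W t x - W s x\<bar> \<le> (exp t - exp s) * R0)"

lemma admissibleD:
  assumes "admissible W" "0 \<le> t"
  shows "0 \<le> W t x" "W t x \<le> (exp t - 1) * R0"
    "\<bar>W t x - W t y\<bar> \<le> (exp t - 1) * \<Lambda> * norm (x - y)"
    "0 \<le> s \<Longrightarrow> s \<le> t \<Longrightarrow> \<bar>W t x - W s x\<bar> \<le> (exp t - exp s) * R0"
  using assms unfolding admissible_def by auto

lemma admissible_borel:
  assumes "admissible W" "0 \<le> t"
  shows "W t \<in> borel_measurable borel"
proof -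
  have "continuous_on UNIV (W t)"
    by (rule lipschitz_on_continuous_on[of "(exp t - 1) * \<Lambda>"])
      (use admissibleD(3)[OF assms] assms(2) \<Lambda>_nonneg in \<open>auto simp: lipschitz_on_def dist_norm\<close>)
  then show ?thesis by (rule borel_measurable_continuous_onI)
qed

lemma admissible_tendsto:
  assumes W: "admissible W" and s: "\<And>n::nat. 0 \<le> s n" "0 \<le> t" "s \<longlonglongrightarrow> t"
  shows "(\<lambda>n. W (s n) x) \<longlonglongrightarrow> W t x"
proof -
  have "(\<lambda>n. \<bar>W (s n) x - W t x\<bar>) \<longlonglongrightarrow> 0"
  proof (rule tendsto_sandwich[OF _ _ tendsto_const])
    show "(\<lambda>n. \<bar>exp (s n) - exp t\<bar> * R0) \<longlonglongrightarrow> 0"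
      by (rule tendsto_eq_intros tendsto_exp s refl | simp)+
    have "\<bar>W r x - W t x\<bar> \<le> \<bar>exp r - exp t\<bar> * R0" if "0 \<le> r" for r
      using admissibleD(4)[OF W, of r t x] admissibleD(4)[OF W, of t r x] that s(2)
      by (cases "r \<le> t") (auto simp: abs_minus_commute)
    then show "\<forall>\<^sub>F n in sequentially. \<bar>W (s n) x - W t x\<bar> \<le> \<bar>exp (s n) - exp t\<bar> * R0"
      using s(1) by (intro always_eventually) blast
  qed simp
  then show ?thesis by (simp add: tendsto_rabs_zero_iff LIM_zero_iff)
qed

end

section \<open>Existence by monotone Picard iteration\<close>

locale neural_field_initial = neural_field +
  fixes u0 :: "'a \<Rightarrow> real"
  assumes u0_borel [measurable]: "u0 \<in> borel_measurable borel"
    and u0_Lp: "abs_aefun u0 \<in> Lp p \<rho>"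
begin

text \<open>The candidate solution encoded by \<open>W\<close>. The companion \<open>source\<close>
  is the time derivative that \<open>W\<close> must then have, so a fixed point of
  \<open>Picard\<close> solves the equation in integrated form.\<close>

definition state :: "(real \<Rightarrow> 'a \<Rightarrow> real) \<Rightarrow> real \<Rightarrow> 'a \<Rightarrow> real" where
  "state W t x = exp (- t) * (u0 x + W t x)"

definition source :: "(real \<Rightarrow> 'a \<Rightarrow> real) \<Rightarrow> 'a \<Rightarrow> real \<Rightarrow> real" where
  "source W x t = exp t * (conv (state W t) x + h)"

definition Picard :: "(real \<Rightarrow> 'a \<Rightarrow> real) \<Rightarrow> real \<Rightarrow> 'a \<Rightarrow> real" where
  "Picard W t x = integral {0..t} (source W x)"

lemma state_measurable:
  assumes "admissible W" "0 \<le> t"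
  shows "state W t \<in> borel_measurable lebesgue"
proof -
  have [measurable]: "W t \<in> borel_measurable borel" by (rule admissible_borel[OF assms])
  have "(\<lambda>x. exp (- t) * (u0 x + W t x)) \<in> borel_measurable borel" by measurable
  then show ?thesis by (intro measurable_completion) (simp add: state_def[abs_def])
qed

lemma state_tendsto:
  assumes W: "admissible W" and s: "\<And>n::nat. 0 \<le> s n" "0 \<le> t" "s \<longlonglongrightarrow> t"
  shows "(\<lambda>n. state W (s n) x) \<longlonglongrightarrow> state W t x"
  unfolding state_def
  by (intro tendsto_intros s admissible_tendsto[OF assms])

lemma source_continuous:
  assumes W: "admissible W"
  shows "continuous_on {0..} (source W x)"
proof (rule continuous_on_sequentiallyI)
  fix s t assume s: "\<forall>n::nat. s n \<in> {0..}" "t \<in> {0::real..}" "s \<longlonglongrightarrow> t"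
  then have "(\<lambda>n. conv (state W (s n)) x) \<longlonglongrightarrow> conv (state W t) x"
    by (intro conv_tendsto state_measurable state_tendsto W) auto
  then show "(\<lambda>n. source W x (s n)) \<longlonglongrightarrow> source W x t"
    unfolding source_def by (intro tendsto_intros s)
qed

lemma source_integrable:
  "admissible W \<Longrightarrow> 0 \<le> s \<Longrightarrow> source W x integrable_on {s..t}"
  by (intro integrable_continuous_real continuous_on_subset[OF source_continuous]) auto

lemma source_bounds:
  assumes "admissible W" "0 \<le> t"
  shows "0 \<le> source W x t" "source W x t \<le> exp t * R0"
  using conv_nonneg[of "state W t" x] conv_le[OF state_measurable[OF assms], of x] h_nonneg
  by (auto simp: source_def R0_def)

lemma exp_has_integral:
  "s \<le> t \<Longrightarrow> ((\<lambda>r. exp r * c) has_integral (exp t - exp s) * c) {s..t::real}"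
  by (intro has_integral_mult_left fundamental_theorem_of_calculus)
    (auto intro!: derivative_eq_intros simp flip: has_real_derivative_iff_has_vector_derivative)

lemma exp_integral: "0 \<le> t \<Longrightarrow> s \<le> t \<Longrightarrow> integral {s..t} (\<lambda>r. exp r * c) = (exp t - exp s) * (c::real)"
  using exp_has_integral integral_unique by blast

lemma exp_integrable: "(\<lambda>r. exp r * (c::real)) integrable_on {s..t}"
  by (intro integrable_continuous_real continuous_intros)

text \<open>The size of \<open>source\<close> and its variation in \<open>x\<close> are bounded by
  constants that do not depend on \<open>W\<close>; integrating these bounds in time reproduces the
  admissible ones without loss.\<close>

lemma Picard_admissible:
  assumes W: "admissible W"
  shows "admissible (Picard W)"
  unfolding admissible_def
proof (intro conjI allI impI)
  fix t x assume t: "0 \<le> (t::real)"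
  show "0 \<le> Picard W t x"
    unfolding Picard_def using source_bounds[OF W]
    by (intro Henstock_Kurzweil_Integration.integral_nonneg source_integrable[OF W]) auto
  have "Picard W t x \<le> integral {0..t} (\<lambda>r. exp r * R0)"
    unfolding Picard_def using source_bounds[OF W]
    by (intro integral_le source_integrable[OF W] exp_integrable) auto
  then show "Picard W t x \<le> (exp t - 1) * R0"
    using t by (simp add: exp_integral)
next
  fix t x y assume t: "0 \<le> (t::real)"
  have eq: "Picard W t x - Picard W t y = integral {0..t} (\<lambda>s. source W x s - source W y s)"
    unfolding Picard_def
    by (intro Henstock_Kurzweil_Integration.integral_diff[symmetric] source_integrable[OF W]) auto
  have "norm (integral {0..t} (\<lambda>s. source W x s - source W y s)) \<le>
      integral {0..t} (\<lambda>r. exp r * (\<Lambda> * norm (x - y)))"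
  proof (rule integral_norm_bound_integral)
    fix s assume "s \<in> {0..t}"
    then have m: "state W s \<in> borel_measurable lebesgue" by (intro state_measurable W) auto
    have "norm (source W x s - source W y s) = exp s * \<bar>conv (state W s) x - conv (state W s) y\<bar>"
      by (simp add: source_def abs_mult flip: right_diff_distrib)
    also have "\<dots> \<le> exp s * (\<Lambda> * norm (x - y))"
      using conv_lipschitz[OF m] by (intro mult_left_mono) auto
    finally show "norm (source W x s - source W y s) \<le> exp s * (\<Lambda> * norm (x - y))" .
  qed (intro Henstock_Kurzweil_Integration.integrable_diff source_integrable[OF W] exp_integrable; simp)+
  then show "\<bar>Picard W t x - Picard W t y\<bar> \<le> (exp t - 1) * \<Lambda> * norm (x - y)"
    using t unfolding eq by (simp add: exp_integral mult.assoc)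
next
  fix s t x assume st: "0 \<le> (s::real)" "s \<le> t"
  have eq: "Picard W t x - Picard W s x = integral {s..t} (source W x)"
    unfolding Picard_def
    using Henstock_Kurzweil_Integration.integral_combine[OF st source_integrable[OF W order_refl], of x] by simp
  have "norm (integral {s..t} (source W x)) \<le> integral {s..t} (\<lambda>r. exp r * R0)"
  proof (rule integral_norm_bound_integral)
    fix r assume "r \<in> {s..t}"
    then show "norm (source W x r) \<le> exp r * R0"
      using source_bounds[OF W, of r x] st by simp
  qed (use st in \<open>auto intro: source_integrable[OF W] exp_integrable\<close>)
  then show "\<bar>Picard W t x - Picard W s x\<bar> \<le> (exp t - exp s) * R0"
    using st unfolding eq by (simp add: exp_integral)
qed

lemma Picard_mono:
  assumes W: "admissible W" "admissible W'" and le: "\<And>t x. 0 \<le> t \<Longrightarrow> W t x \<le> W' t x"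
    and t: "0 \<le> t"
  shows "Picard W t x \<le> Picard W' t x"
  unfolding Picard_def
proof (intro integral_le source_integrable W order_refl)
  fix s assume "s \<in> {0..t}"
  then have s: "0 \<le> s" by simp
  then have "conv (state W s) x \<le> conv (state W' s) x"
    using le by (intro conv_mono state_measurable W) (auto simp: state_def)
  then show "source W x s \<le> source W' x s" by (simp add: source_def)
qed

primrec iter :: "nat \<Rightarrow> real \<Rightarrow> 'a \<Rightarrow> real" where
  "iter 0 = (\<lambda>t x. 0)"
| "iter (Suc n) = Picard (iter n)"

lemma iter_admissible: "admissible (iter n)"
proof (induction n)
  case 0
  show ?case using R0_nonneg \<Lambda>_nonneg by (auto simp: admissible_def)
qed (simp add: Picard_admissible)

text \<open>The induction starts because admissible functions are nonnegative and the initial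
  iterate is 0, the least of them.\<close>

lemma iter_mono: "0 \<le> t \<Longrightarrow> iter n t x \<le> iter (Suc n) t x"
proof (induction n arbitrary: t x)
  case 0
  then show ?case using admissibleD(1)[OF iter_admissible[of 1]] by simp
next
  case (Suc n)
  show ?case
    unfolding iter.simps(2)[of "Suc n"] iter.simps(2)[of n]
    using Picard_mono[of "iter n" "Picard (iter n)"] Suc iter_admissible Picard_admissible
    by simp
qed

definition limit :: "real \<Rightarrow> 'a \<Rightarrow> real" where
  "limit t x = lim (\<lambda>n. iter n t x)"

lemma iter_tendsto:
  assumes "0 \<le> t" shows "(\<lambda>n. iter n t x) \<longlonglongrightarrow> limit t x"
proof -
  have "incseq (\<lambda>n. iter n t x)" using iter_mono[OF assms] by (intro incseq_SucI)
  then have "convergent (\<lambda>n. iter n t x)"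
    using admissibleD(2)[OF iter_admissible assms] by (metis incseq_convergent convergentI)
  then show ?thesis by (simp add: limit_def convergent_LIMSEQ_iff)
qed

lemma limit_admissible: "admissible limit"
  unfolding admissible_def
proof (intro conjI allI impI)
  fix t x assume t: "0 \<le> (t::real)"
  show "0 \<le> limit t x"
    by (rule LIMSEQ_le_const[OF iter_tendsto[OF t]]) (use admissibleD(1)[OF iter_admissible t] in blast)
  show "limit t x \<le> (exp t - 1) * R0"
    by (rule LIMSEQ_le_const2[OF iter_tendsto[OF t]]) (use admissibleD(2)[OF iter_admissible t] in blast)
next
  fix t x y assume t: "0 \<le> (t::real)"
  have "(\<lambda>n. \<bar>iter n t x - iter n t y\<bar>) \<longlonglongrightarrow> \<bar>limit t x - limit t y\<bar>"
    by (intro tendsto_intros iter_tendsto t)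
  then show "\<bar>limit t x - limit t y\<bar> \<le> (exp t - 1) * \<Lambda> * norm (x - y)"
    by (rule LIMSEQ_le_const2) (use admissibleD(3)[OF iter_admissible t] in blast)
next
  fix s t x assume st: "0 \<le> (s::real)" "s \<le> t"
  have "(\<lambda>n. \<bar>iter n t x - iter n s x\<bar>) \<longlonglongrightarrow> \<bar>limit t x - limit s x\<bar>"
    using st by (intro tendsto_intros iter_tendsto) auto
  then show "\<bar>limit t x - limit s x\<bar> \<le> (exp t - exp s) * R0"
    by (rule LIMSEQ_le_const2) (use admissibleD(4)[OF iter_admissible] st in auto)
qed

text \<open>Dominated convergence at two levels: in the space integral under
  \<open>a * J (x - y)\<close>, and in the time integral under \<open>exp s * R0\<close>.\<close>

lemma limit_fixed_point:
  assumes t: "0 \<le> t" shows "limit t x = Picard limit t x"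
proof -
  have "(\<lambda>n. Picard (iter n) t x) \<longlonglongrightarrow> Picard limit t x"
    unfolding Picard_def
  proof (rule dominated_convergence(2))
    show "source (iter n) x integrable_on {0..t}" for n
      by (rule source_integrable[OF iter_admissible order_refl])
    show "(\<lambda>r. exp r * R0) integrable_on {0..t}" by (rule exp_integrable)
    show "norm (source (iter n) x s) \<le> exp s * R0" if "s \<in> {0..t}" for n s
      using source_bounds[OF iter_admissible, of s n x] that by simp
    show "(\<lambda>n. source (iter n) x s) \<longlonglongrightarrow> source limit x s" if "s \<in> {0..t}" for s
      unfolding source_def using that
      by (intro tendsto_intros conv_tendsto state_measurable iter_admissible limit_admissible)
        (auto simp: state_def intro!: tendsto_intros iter_tendsto)
  qed
  moreover have "(\<lambda>n. Picard (iter n) t x) \<longlonglongrightarrow> limit t x"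
    using LIMSEQ_Suc[OF iter_tendsto[OF t, of x]] by simp
  ultimately show ?thesis using LIMSEQ_unique by blast
qed

lemma limit_has_derivative:
  assumes t: "0 \<le> t"
  shows "((\<lambda>t. limit t x) has_real_derivative source limit x t) (at t within {0..})"
proof -
  have "((\<lambda>t. integral {0..t} (source limit x)) has_real_derivative source limit x t) (at t within {0..t + 1})"
    by (rule integral_has_real_derivative)
      (use t in \<open>auto intro: continuous_on_subset[OF source_continuous[OF limit_admissible]]\<close>)
  \<comment> \<open>An interval reaching beyond \<open>t\<close> is a neighbourhood of
    \<open>t\<close> in the half-line, so the derivative is two-sided for positive \<open>t\<close>
    and one-sided at 0.\<close>
  moreover have "at t within {0..t + 1} = at t within {0..}"
    by (rule at_within_nhd[of t "{..<t + 1}"]) auto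
  ultimately have "((\<lambda>t. Picard limit t x) has_real_derivative source limit x t) (at t within {0..})"
    by (simp add: Picard_def)
  then show ?thesis
    by (rule has_field_derivative_transform_within[OF _ zero_less_one])
      (use t limit_fixed_point in auto)
qed

section \<open>The bounded remainder and differentiability in norm\<close>

definition w :: "real \<Rightarrow> 'a \<Rightarrow> real" where "w t x = exp (- t) * limit t x"

text \<open>The full right-hand side without the contribution \<open>- exp (- t) * u0\<close> of the
  decaying part; this is what keeps it bounded when \<open>u0\<close> is not.\<close>

definition w' :: "real \<Rightarrow> 'a \<Rightarrow> real" where "w' t x = - w t x + conv (state limit t) x + h"

lemma w_bounds:
  assumes "0 \<le> t" shows "0 \<le> w t x" "w t x \<le> R0"
proof -
  show "0 \<le> w t x" using admissibleD(1)[OF limit_admissible assms] by (simp add: w_def)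
  have "w t x \<le> exp (- t) * ((exp t - 1) * R0)"
    using admissibleD(2)[OF limit_admissible assms] by (simp add: w_def)
  also have "\<dots> = (1 - exp (- t)) * R0" by (simp add: algebra_simps flip: exp_add)
  also have "\<dots> \<le> 1 * R0" using R0_nonneg by (intro mult_right_mono) auto
  finally show "w t x \<le> R0" by simp
qed

lemma w_lipschitz:
  assumes "0 \<le> t" shows "\<bar>w t x - w t y\<bar> \<le> \<Lambda> * norm (x - y)"
proof -
  have "\<bar>w t x - w t y\<bar> = exp (- t) * \<bar>limit t x - limit t y\<bar>"
    by (simp add: w_def abs_mult flip: right_diff_distrib)
  also have "\<dots> \<le> exp (- t) * ((exp t - 1) * \<Lambda> * norm (x - y))"
    using admissibleD(3)[OF limit_admissible assms] by (intro mult_left_mono) auto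
  also have "\<dots> = (1 - exp (- t)) * (\<Lambda> * norm (x - y))" by (simp add: algebra_simps flip: exp_add)
  also have "\<dots> \<le> 1 * (\<Lambda> * norm (x - y))" using \<Lambda>_nonneg by (intro mult_right_mono) auto
  finally show ?thesis by simp
qed

lemma w_measurable:
  assumes "0 \<le> t" shows "w t \<in> borel_measurable lebesgue"
proof -
  have "(\<lambda>x. exp (- t) * limit t x) \<in> borel_measurable borel"
    using admissible_borel[OF limit_admissible assms] by measurable
  then show ?thesis by (intro measurable_completion) (simp add: w_def[abs_def])
qed

lemma w_has_derivative:
  assumes t: "0 \<le> t"
  shows "((\<lambda>t. w t x) has_real_derivative w' t x) (at t within {0..})"
  unfolding w_def
  by (rule derivative_eq_intros limit_has_derivative[OF t] refl)+
    (simp add: w'_def w_def source_def algebra_simps flip: exp_add)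

text \<open>Both \<open>w t x\<close> and the convolution plus \<open>h\<close> lie between 0 and
  \<open>R0\<close>, so their difference is at most \<open>R0\<close> in absolute value.\<close>

lemma w'_bound: 
  assumes t: "0 \<le> t" shows "\<bar>w' t x\<bar> \<le> R0"
  using w_bounds[OF t, of x] conv_nonneg[of "state limit t" x]
    conv_le[OF state_measurable[OF limit_admissible t], of x] h_nonneg
  unfolding w'_def R0_def by linarith

lemma w_time_lipschitz:
  assumes "0 \<le> s" "0 \<le> t" shows "\<bar>w s x - w t x\<bar> \<le> R0 * \<bar>s - t\<bar>"
  using field_differentiable_bound[of "{0..}" "\<lambda>t. w t x" "\<lambda>t. w' t x" R0 s t]
    w_has_derivative w'_bound assms by auto

definition sol :: "real \<Rightarrow> 'a aefun" where
  "sol t = exp (- t) *\<^sub>R abs_aefun u0 + abs_aefun (w t)"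

lemma sol_eq_state: "sol t = abs_aefun (state limit t)"
  by (simp add: sol_def scaleR_abs_aefun plus_abs_aefun state_def[abs_def] w_def[abs_def] algebra_simps)

lemma w_in_Lp: "0 \<le> t \<Longrightarrow> abs_aefun (w t) \<in> Lp p \<rho>"
  using w_bounds by (intro bounded_in_Lp[of _ R0] w_measurable) auto

lemma sol_in_Lp: "0 \<le> t \<Longrightarrow> sol t \<in> Lp p \<rho>"
  unfolding sol_def by (intro Lp_add Lp_scaleR u0_Lp w_in_Lp)

lemma sol_0: "sol 0 = abs_aefun u0"
proof -
  have "w 0 x = 0" for x using limit_fixed_point[of 0 x] by (simp add: w_def Picard_def)
  then have "w 0 = (\<lambda>x. 0)" by blast
  then show ?thesis by (simp add: sol_def flip: zero_abs_aefun)
qed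

text \<open>The quotient error is a scalar error for \<open>exp (- t)\<close> times
  \<open>u0\<close>, plus an error for \<open>w\<close>. The first is handled by homogeneity of the
  norm, so \<open>u0\<close> may be unbounded; the second is at most \<open>2 * R0\<close> and tends
  to 0 pointwise, so dominated convergence applies.\<close>

lemma sol_solution: "Lp_ode_solution p \<rho> (neural_rhs J f h) sol"
  unfolding Lp_ode_solution_def
proof (intro allI impI conjI sol_in_Lp)
  fix t :: real assume t: "0 \<le> t"
  define c where "c s = (exp (- s) - exp (- t)) / (s - t) + exp (- t)" for s
  define q where "q s x = (w s x - w t x) / (s - t) - w' t x" for s x
  have split: "(1 / (s - t)) *\<^sub>R (sol s - sol t) - neural_rhs J f h (sol t) =
      c s *\<^sub>R abs_aefun u0 + abs_aefun (q s)" for s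
  proof -
    have "(1 / (s - t)) *\<^sub>R (sol s - sol t) - neural_rhs J f h (sol t) =
      abs_aefun (\<lambda>x. (1 / (s - t)) * (state limit s x - state limit t x) -
        (- state limit t x + conv (state limit t) x + h))"
      by (simp only: sol_eq_state neural_rhs_abs minus_abs_aefun scaleR_abs_aefun)
    also have "(\<lambda>x. (1 / (s - t)) * (state limit s x - state limit t x) -
        (- state limit t x + conv (state limit t) x + h)) = (\<lambda>x. c s * u0 x + q s x)"
      by (rule ext) (simp add: c_def q_def w'_def w_def state_def algebra_simps diff_divide_distrib)
    finally show ?thesis by (simp add: scaleR_abs_aefun plus_abs_aefun)
  qed
  show "((\<lambda>s. Lp_norm p \<rho> ((1 / (s - t)) *\<^sub>R (sol s - sol t) - neural_rhs J f h (sol t))) \<longlongrightarrow> 0)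
      (at t within {0..})"
    unfolding tendsto_at_iff_sequentially
  proof (intro allI impI)
    fix X assume X: "\<forall>i::nat. X i \<in> {0..} - {t}" and lim: "X \<longlonglongrightarrow> t"
    have Xt: "filterlim X (at t within {0..}) sequentially"
      using X lim by (auto simp: filterlim_at)
    have qm: "q (X i) \<in> borel_measurable lebesgue" for i
    proof -
      have [measurable]: "w (X i) \<in> borel_measurable lebesgue" "w t \<in> borel_measurable lebesgue"
        using X t by (auto intro!: w_measurable)
      have [measurable]: "conv (state limit t) \<in> borel_measurable lebesgue"
        using conv_borel[OF state_measurable[OF limit_admissible t]]
        by (intro measurable_completion) simp
      show ?thesis unfolding q_def[abs_def] w'_def by measurable
    qed
    have qb: "\<bar>q (X i) x\<bar> \<le> 2 * R0" for i x
    proof -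
      have "\<bar>(w (X i) x - w t x) / (X i - t)\<bar> \<le> R0"
        using w_time_lipschitz[of "X i" t x] X t by (simp add: divide_le_eq)
      then show ?thesis using w'_bound[OF t, of x] unfolding q_def by linarith
    qed
    have ql: "(\<lambda>i. q (X i) x) \<longlonglongrightarrow> 0" for x
    proof -
      have "((\<lambda>s. (w s x - w t x) / (s - t)) \<longlongrightarrow> w' t x) (at t within {0..})"
        using w_has_derivative[OF t] by (simp add: has_field_derivative_iff)
      from filterlim_compose[OF this Xt] show ?thesis
        unfolding q_def using LIM_zero by blast
    qed
    have cl: "(\<lambda>i. c (X i)) \<longlonglongrightarrow> 0"
    proof -
      have "((\<lambda>s. exp (- s)) has_real_derivative - exp (- t)) (at t within {0..})"
        by (auto intro!: derivative_eq_intros)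
      then have "((\<lambda>s. (exp (- s) - exp (- t)) / (s - t)) \<longlongrightarrow> - exp (- t)) (at t within {0..})"
        by (simp add: has_field_derivative_iff)
      from tendsto_add[OF filterlim_compose[OF this Xt] tendsto_const[of "exp (- t)"]]
      show ?thesis by (simp add: c_def)
    qed
    have "(\<lambda>i. \<bar>c (X i)\<bar> * Lp_norm p \<rho> (abs_aefun u0) + Lp_norm p \<rho> (abs_aefun (q (X i)))) \<longlonglongrightarrow>
        0 * Lp_norm p \<rho> (abs_aefun u0) + 0"
      by (intro tendsto_add tendsto_mult tendsto_const tendsto_rabs_zero cl
          Lp_norm_bounded_convergence[of _ "2 * R0"] qm qb ql)
    then have lim0: "(\<lambda>i. \<bar>c (X i)\<bar> * Lp_norm p \<rho> (abs_aefun u0) + Lp_norm p \<rho> (abs_aefun (q (X i)))) \<longlonglongrightarrow> 0"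
      by simp
    have "Lp_norm p \<rho> (c (X i) *\<^sub>R abs_aefun u0 + abs_aefun (q (X i))) \<le>
        \<bar>c (X i)\<bar> * Lp_norm p \<rho> (abs_aefun u0) + Lp_norm p \<rho> (abs_aefun (q (X i)))" for i
      using Lp_norm_triangle[OF Lp_scaleR[OF u0_Lp, of "c (X i)"] bounded_in_Lp[OF qm qb, of i]]
      by (simp add: Lp_norm_scaleR)
    then show "((\<lambda>s. Lp_norm p \<rho> ((1 / (s - t)) *\<^sub>R (sol s - sol t) - neural_rhs J f h (sol t))) \<circ> X) \<longlonglongrightarrow> 0"
      unfolding split o_def
      by (intro tendsto_sandwich[OF _ _ tendsto_const lim0] always_eventually allI Lp_norm_nonneg) simp
  qed
qed

end

section \<open>The flow and its attractor\<close>

text \<open>A diagonal subsequence converges on a countable dense set, and the common Lipschitz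
  constant spreads the Cauchy property to every point.\<close>

lemma equi_Lipschitz_subsequence:
  fixes g :: "nat \<Rightarrow> 'a::euclidean_space \<Rightarrow> real"
  assumes bound: "\<And>n x. \<bar>g n x\<bar> \<le> C"
    and lip: "\<And>n x y. \<bar>g n x - g n y\<bar> \<le> L * norm (x - y)"
  obtains r l where "strict_mono (r::nat \<Rightarrow> nat)" "\<And>x. (\<lambda>n. g (r n) x) \<longlonglongrightarrow> l x"
proof -
  obtain D :: "'a set" where D: "countable D" "\<And>X. open X \<Longrightarrow> X \<noteq> {} \<Longrightarrow> \<exists>d\<in>D. d \<in> X"
    using countable_dense_setE by blast
  obtain r where r: "strict_mono (r::nat \<Rightarrow> nat)" "\<And>x. x \<in> D \<Longrightarrow> \<exists>l. (\<lambda>n. g (r n) x) \<longlonglongrightarrow> l"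
    by (rule function_convergent_subsequence[OF D(1), of g C]) (use bound in auto)
  have "convergent (\<lambda>n. g (r n) x)" for x
  proof (rule Cauchy_convergent, rule metric_CauchyI)
    fix e :: real assume e: "0 < e"
    \<comment> \<open>Three errors of size \<open>e / 3\<close> will be added: two for moving to the
      dense point, one for convergence there.\<close>
    define \<delta> where "\<delta> = e / (3 * (\<bar>L\<bar> + 1))"
    have \<delta>: "0 < \<delta>" using e by (simp add: \<delta>_def)
    obtain d where d: "d \<in> D" "d \<in> ball x \<delta>" using D(2)[of "ball x \<delta>"] \<delta> by auto
    have close: "\<bar>g n x - g n d\<bar> < e / 3" for n
    proof -
      have "\<bar>g n x - g n d\<bar> \<le> L * norm (x - d)" by (rule lip)
      also have "\<dots> \<le> (\<bar>L\<bar> + 1) * norm (x - d)" by (intro mult_right_mono) auto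
      also have "\<dots> < (\<bar>L\<bar> + 1) * \<delta>" using d by (intro mult_strict_left_mono) (auto simp: dist_norm)
      also have "\<dots> = e / 3" by (simp add: \<delta>_def field_simps)
      finally show ?thesis .
    qed
    have "Cauchy (\<lambda>n. g (r n) d)" using r(2)[OF d(1)] convergent_Cauchy convergentI by blast
    then obtain N where N: "\<And>m n. m \<ge> N \<Longrightarrow> n \<ge> N \<Longrightarrow> dist (g (r m) d) (g (r n) d) < e / 3"
      using e metric_CauchyD[of "\<lambda>n. g (r n) d" "e / 3"] by auto
    have "dist (g (r m) x) (g (r n) x) < e" if "m \<ge> N" "n \<ge> N" for m n
      using N[OF that] close[of "r m"] close[of "r n"] unfolding dist_real_def by linarith
    then show "\<exists>N. \<forall>m\<ge>N. \<forall>n\<ge>N. dist (g (r m) x) (g (r n) x) < e" by blast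
  qed
  then show ?thesis
    by (intro that[OF r(1), of "\<lambda>x. lim (\<lambda>n. g (r n) x)"]) (simp add: convergent_LIMSEQ_iff)
qed

context neural_field
begin

section \<open>Uniqueness and continuous dependence in \<open>L^1(\<rho>)\<close>\<close>

abbreviation F :: "'a aefun \<Rightarrow> 'a aefun" where "F \<equiv> neural_rhs J f h"

abbreviation flow :: "real \<Rightarrow> 'a aefun \<Rightarrow> 'a aefun" where "flow \<equiv> Lp_flow p \<rho> F"

lemma solution_in_Lp: "Lp_ode_solution p \<rho> F u \<Longrightarrow> 0 \<le> t \<Longrightarrow> u t \<in> Lp p \<rho>"
  by (simp add: Lp_ode_solution_def)

text \<open>Differentiability passes to the weaker norm; the factor 2 in \<open>Lp_subset_L1\<close>
  is why \<open>e / 2\<close> is used inside.\<close>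

lemma solution_quotient_L1:
  assumes u: "Lp_ode_solution p \<rho> F u" and t: "0 \<le> t" and e: "0 < e"
  shows "eventually (\<lambda>s. Lp_norm 1 \<rho> ((1 / (s - t)) *\<^sub>R (u s - u t) - F (u t)) < e) (at t within {0..})"
proof -
  have "((\<lambda>s. Lp_norm p \<rho> ((1 / (s - t)) *\<^sub>R (u s - u t) - F (u t))) \<longlongrightarrow> 0) (at t within {0..})"
    using u t by (simp add: Lp_ode_solution_def)
  then have "eventually (\<lambda>s. Lp_norm p \<rho> ((1 / (s - t)) *\<^sub>R (u s - u t) - F (u t)) < e / 2) (at t within {0..})"
    using e by (intro order_tendstoD) auto
  moreover have "eventually (\<lambda>s. s \<in> {0..}) (at t within {0..})"
    by (simp add: eventually_at_filter)
  ultimately show ?thesis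
  proof eventually_elim
    case (elim s)
    then have "(1 / (s - t)) *\<^sub>R (u s - u t) - F (u t) \<in> Lp p \<rho>"
      using u t by (intro Lp_diff Lp_scaleR neural_rhs_in_Lp solution_in_Lp[OF u]) auto
    from Lp_subset_L1(2)[OF this] elim show ?case by linarith
  qed
qed

text \<open>The norm of a difference of solutions need not be differentiable in time, so only
  one-step estimates with small error are derived for \<open>Dini_Gronwall\<close>. Each difference
  quotient contributes an error below \<open>e / 2\<close>, the Lipschitz estimate the linear
  term.\<close>

lemma solution_L1_dependence:
  assumes u: "Lp_ode_solution p \<rho> F u" and v: "Lp_ode_solution p \<rho> F v" and T: "0 \<le> T"
  shows "Lp_norm 1 \<rho> (u T - v T) \<le> exp (2 * Lip * T) * Lp_norm 1 \<rho> (u 0 - v 0)"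
proof (rule Dini_Gronwall[OF Lip_nonneg T])
  interpret L1: weighted_Lp 1 \<rho> by (rule weighted_L1)
  show "0 \<le> Lp_norm 1 \<rho> (u t - v t)" for t by (rule L1.Lp_norm_nonneg)
  fix t e :: real assume t: "0 \<le> t" and e: "0 < e"
  define D where "D s = u s - v s" for s
  have D_L1: "D s \<in> Lp 1 \<rho>" if "0 \<le> s" for s
    unfolding D_def using that by (intro Lp_subset_L1(1) Lp_diff solution_in_Lp[OF u] solution_in_Lp[OF v])
  define Q where "Q u s = (1 / (s - t)) *\<^sub>R (u s - u t) - F (u t)" for u :: "real \<Rightarrow> 'a aefun" and s
  have Q_L1: "Q x s \<in> Lp 1 \<rho>" if "Lp_ode_solution p \<rho> F x" "0 \<le> s" for x s
    unfolding Q_def using that t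
    by (intro Lp_subset_L1(1) Lp_diff Lp_scaleR neural_rhs_in_Lp solution_in_Lp) auto
  have FL1: "F (u t) - F (v t) \<in> Lp 1 \<rho>"
    using t by (intro Lp_subset_L1(1) Lp_diff neural_rhs_in_Lp solution_in_Lp[OF u] solution_in_Lp[OF v])
  have "eventually (\<lambda>s. Lp_norm 1 \<rho> (Q u s) < e / 2 \<and> Lp_norm 1 \<rho> (Q v s) < e / 2) (at t within {0..})"
    unfolding Q_def using e
    by (intro eventually_conj solution_quotient_L1 u v t) auto
  then obtain \<delta> where \<delta>: "0 < \<delta>" "\<And>s. 0 \<le> s \<Longrightarrow> s \<noteq> t \<Longrightarrow> \<bar>s - t\<bar> < \<delta> \<Longrightarrow>
      Lp_norm 1 \<rho> (Q u s) < e / 2 \<and> Lp_norm 1 \<rho> (Q v s) < e / 2"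
    unfolding eventually_at by (auto simp: dist_real_def)
  have key: "Lp_norm 1 \<rho> (D s - D t) \<le> \<bar>s - t\<bar> * (Lip * Lp_norm 1 \<rho> (D t) + e)"
    if s: "0 \<le> s" "\<bar>s - t\<bar> < \<delta>" for s
  proof (cases "s = t")
    case False
    have "(s - t) *\<^sub>R Q x s = (x s - x t) - (s - t) *\<^sub>R F (x t)" for x
      using False by (simp add: Q_def scaleR_diff_right)
    then have "D s - D t = (s - t) *\<^sub>R ((F (u t) - F (v t)) + (Q u s - Q v s))"
      by (simp add: D_def scaleR_add_right scaleR_diff_right)
    then have "Lp_norm 1 \<rho> (D s - D t) = \<bar>s - t\<bar> * Lp_norm 1 \<rho> ((F (u t) - F (v t)) + (Q u s - Q v s))"
      by (simp add: L1.Lp_norm_scaleR)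
    also have "Lp_norm 1 \<rho> ((F (u t) - F (v t)) + (Q u s - Q v s)) \<le> Lip * Lp_norm 1 \<rho> (D t) + e"
    proof -
      have "Lp_norm 1 \<rho> (Q u s - Q v s) \<le> Lp_norm 1 \<rho> (Q u s) + Lp_norm 1 \<rho> (Q v s)"
        using L1.Lp_norm_triangle[OF Q_L1[OF u s(1)] L1.Lp_uminus[OF Q_L1[OF v s(1)]]]
        by (simp add: L1.Lp_norm_uminus)
      moreover have "Lp_norm 1 \<rho> (F (u t) - F (v t)) \<le> Lip * Lp_norm 1 \<rho> (D t)"
        unfolding D_def using t
        by (intro neural_rhs_L1_lipschitz solution_in_Lp[OF u] solution_in_Lp[OF v])
      ultimately show ?thesis
        using \<delta>(2)[OF s(1) False s(2)]
          L1.Lp_norm_triangle[OF FL1 L1.Lp_diff[OF Q_L1[OF u s(1)] Q_L1[OF v s(1)]]]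
        by linarith
    qed
    finally show ?thesis by (simp add: mult_left_mono)
  qed (use L1.Lp_norm_zero in simp)
  have "Lp_norm 1 \<rho> (D s) \<le> Lp_norm 1 \<rho> (D t) + Lp_norm 1 \<rho> (D s - D t)"
    "Lp_norm 1 \<rho> (D t) \<le> Lp_norm 1 \<rho> (D s) + Lp_norm 1 \<rho> (D s - D t)" if "0 \<le> s" for s
    using L1.Lp_norm_triangle[OF D_L1[OF t] L1.Lp_diff[OF D_L1[OF that] D_L1[OF t]]]
      L1.Lp_norm_triangle[OF D_L1[OF that] L1.Lp_diff[OF D_L1[OF t] D_L1[OF that]]]
      L1.Lp_norm_uminus[of "D s - D t"] by auto
  with key have "\<forall>s\<ge>0. \<bar>s - t\<bar> < \<delta> \<longrightarrow>
      (t \<le> s \<longrightarrow> Lp_norm 1 \<rho> (D s) \<le> Lp_norm 1 \<rho> (D t) + (s - t) * (Lip * Lp_norm 1 \<rho> (D t) + e)) \<and>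
      (s \<le> t \<longrightarrow> Lp_norm 1 \<rho> (D t) \<le> Lp_norm 1 \<rho> (D s) + (t - s) * (Lip * Lp_norm 1 \<rho> (D t) + e))"
    by (smt (verit, best))
  with \<delta>(1) show "\<exists>\<delta>>0. \<forall>s\<ge>0. \<bar>s - t\<bar> < \<delta> \<longrightarrow>
      (t \<le> s \<longrightarrow> Lp_norm 1 \<rho> (u s - v s) \<le> Lp_norm 1 \<rho> (u t - v t) + (s - t) * (Lip * Lp_norm 1 \<rho> (u t - v t) + e)) \<and>
      (s \<le> t \<longrightarrow> Lp_norm 1 \<rho> (u t - v t) \<le> Lp_norm 1 \<rho> (u s - v s) + (t - s) * (Lip * Lp_norm 1 \<rho> (u t - v t) + e))"
    unfolding D_def by blast
qed

lemma solution_unique: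
  assumes u: "Lp_ode_solution p \<rho> F u" and v: "Lp_ode_solution p \<rho> F v" and "u 0 = v 0" and t: "0 \<le> t"
  shows "u t = v t"
proof -
  interpret L1: weighted_Lp 1 \<rho> by (rule weighted_L1)
  have "Lp_norm 1 \<rho> (u t - v t) \<le> 0"
    using solution_L1_dependence[OF u v t] assms(3) by (simp add: L1.Lp_norm_zero)
  then have "Lp_norm 1 \<rho> (u t - v t) = 0" using L1.Lp_norm_nonneg[of "u t - v t"] by simp
  moreover have "u t - v t \<in> Lp 1 \<rho>"
    using t by (intro Lp_subset_L1(1) Lp_diff solution_in_Lp[OF u] solution_in_Lp[OF v])
  ultimately show ?thesis using L1.Lp_norm_eq_0 by fastforce
qed

lemma flow_eq:
  assumes u: "Lp_ode_solution p \<rho> F u" and t: "0 \<le> t"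
  shows "flow t (u 0) = u t"
  unfolding Lp_flow_def
  by (rule the_equality) (use u t solution_unique in blast)+

section \<open>Decaying part and remainder of the flow\<close>

definition remainder :: "('a \<Rightarrow> real) \<Rightarrow> bool" where
  "remainder w \<longleftrightarrow> w \<in> borel_measurable lebesgue \<and> (\<forall>x. 0 \<le> w x \<and> w x \<le> R0) \<and>
    (\<forall>x y. \<bar>w x - w y\<bar> \<le> \<Lambda> * norm (x - y))"

lemma remainderD:
  assumes "remainder w"
  shows "w \<in> borel_measurable lebesgue" "0 \<le> w x" "w x \<le> R0"
    "\<bar>w x - w y\<bar> \<le> \<Lambda> * norm (x - y)"
  using assms by (auto simp: remainder_def)

text \<open>The Picard construction is run for a Borel representative of \<open>U\<close>; its
  solution gives existence, and uniqueness identifies it with the flow.\<close>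

lemma flow_decomposition:
  assumes U: "U \<in> Lp p \<rho>"
  shows solution_exists: "\<exists>u. Lp_ode_solution p \<rho> F u \<and> u 0 = U"
    and flow_remainder: "0 \<le> t \<Longrightarrow> \<exists>w. flow t U = exp (- t) *\<^sub>R U + abs_aefun w \<and> remainder w"
proof -
  obtain u0 where u0: "U = abs_aefun u0" "u0 \<in> borel_measurable borel"
    using Lp_borel_cases[OF U] .
  interpret I: neural_field_initial p \<rho> J f h a k K M u0
    using u0 U by unfold_locales auto
  have sol_0: "I.sol 0 = U" by (simp add: I.sol_0 u0)
  then show "\<exists>u. Lp_ode_solution p \<rho> F u \<and> u 0 = U" using I.sol_solution by blast
  assume t: "0 \<le> t"
  have "flow t U = I.sol t"
    using flow_eq[OF I.sol_solution t] sol_0 by simp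
  then show "\<exists>w. flow t U = exp (- t) *\<^sub>R U + abs_aefun w \<and> remainder w"
    using I.w_measurable[OF t] I.w_bounds[OF t] I.w_lipschitz[OF t]
    by (intro exI[of _ "I.w t"]) (simp add: I.sol_def u0 remainder_def)
qed

lemma flow_in_Lp:
  assumes "0 \<le> t" "U \<in> Lp p \<rho>" shows "flow t U \<in> Lp p \<rho>"
proof -
  obtain u where u: "Lp_ode_solution p \<rho> F u" "u 0 = U" using solution_exists[OF assms(2)] by blast
  then show ?thesis using flow_eq[OF u(1) assms(1)] solution_in_Lp[OF u(1) assms(1)] by simp
qed

lemma flow_norm_le:
  assumes U: "U \<in> Lp p \<rho>" and t: "0 \<le> t"
  shows "Lp_norm p \<rho> (flow t U) \<le> exp (- t) * Lp_norm p \<rho> U + R0"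
proof -
  obtain w where w: "flow t U = exp (- t) *\<^sub>R U + abs_aefun w" "remainder w"
    using flow_remainder[OF U t] by blast
  note w = w(1) remainderD[OF w(2)]
  have "abs_aefun w \<in> Lp p \<rho>" "Lp_norm p \<rho> (abs_aefun w) \<le> R0"
    using w by (auto intro!: bounded_in_Lp[of _ R0] Lp_norm_bounded_le)
  then show ?thesis
    using Lp_norm_triangle[OF Lp_scaleR[OF U, of "exp (- t)"], of "abs_aefun w"] w(1)
    by (simp add: Lp_norm_scaleR)
qed

section \<open>Semigroup property and continuity of the flow\<close>

lemma solution_shift:
  assumes u: "Lp_ode_solution p \<rho> F u" and s: "0 \<le> s"
  shows "Lp_ode_solution p \<rho> F (\<lambda>t. u (t + s))"
  unfolding Lp_ode_solution_def
proof (intro allI impI conjI)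
  fix t :: real assume t: "0 \<le> t"
  then show "u (t + s) \<in> Lp p \<rho>" using solution_in_Lp[OF u] s by simp
  have "((\<lambda>r. Lp_norm p \<rho> ((1 / (r - (t + s))) *\<^sub>R (u r - u (t + s)) - F (u (t + s)))) \<longlongrightarrow> 0)
      (at (t + s) within {0..})"
    using u t s by (simp add: Lp_ode_solution_def)
  \<comment> \<open>Adding \<open>s \<ge> 0\<close> maps the half-line into itself, so the limit at
    \<open>t + s\<close> restricts to the shifted one; at \<open>t = 0\<close> only quotients to the
    right of \<open>s\<close> remain.\<close>
  moreover have "filterlim (\<lambda>r. r + s) (at (t + s) within {0..}) (at t within {0..})"
    using s by (auto simp: filterlim_at eventually_at_filter intro!: tendsto_intros)
  ultimately show "((\<lambda>r. Lp_norm p \<rho> ((1 / (r - t)) *\<^sub>R (u (r + s) - u (t + s)) - F (u (t + s)))) \<longlongrightarrow> 0)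
      (at t within {0..})"
    by (auto dest: filterlim_compose)
qed

lemma flow_add:
  assumes s: "0 \<le> s" and t: "0 \<le> t" and U: "U \<in> Lp p \<rho>"
  shows "flow (s + t) U = flow s (flow t U)"
proof -
  obtain u where u: "Lp_ode_solution p \<rho> F u" "u 0 = U"
    using solution_exists[OF U] by blast
  have "flow s (flow t U) = flow s (u (0 + t))" using flow_eq[OF u(1) t] u(2) by simp
  also have "\<dots> = u (s + t)" by (rule flow_eq[OF solution_shift[OF u(1) t] s])
  also have "\<dots> = flow (s + t) U" using flow_eq[OF u(1), of "s + t"] u(2) s t by simp
  finally show ?thesis ..
qed

lemma flow_L1_lipschitz:
  assumes U: "U \<in> Lp p \<rho>" and V: "V \<in> Lp p \<rho>" and t: "0 \<le> t"
  shows "Lp_norm 1 \<rho> (flow t U - flow t V) \<le> exp (2 * Lip * t) * Lp_norm 1 \<rho> (U - V)"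
proof -
  obtain u where u: "Lp_ode_solution p \<rho> F u" "u 0 = U" using solution_exists[OF U] by blast
  obtain v where v: "Lp_ode_solution p \<rho> F v" "v 0 = V" using solution_exists[OF V] by blast
  show ?thesis
    using solution_L1_dependence[OF u(1) v(1) t] flow_eq[OF u(1) t] flow_eq[OF v(1) t] u(2) v(2) by simp
qed

text \<open>The difference of two orbits is \<open>exp (- t)\<close> times the initial difference,
  which does not grow in norm, plus a difference of remainders. The latter is bounded pointwise, so
  its norm is controlled by its \<open>L^1(\<rho>)\<close> norm to the power
  \<open>1 / p\<close>.\<close>

lemma flow_modulus:
  assumes U: "U \<in> Lp p \<rho>" and V: "V \<in> Lp p \<rho>" and t: "0 \<le> t"
  shows "Lp_dist p \<rho> (flow t U) (flow t V) \<le> Lp_dist p \<rho> U V +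
    (R0 powr (p - 1) * (2 * (exp (2 * Lip * t) + 1) * Lp_dist p \<rho> U V)) powr (1 / p)"
proof -
  interpret L1: weighted_Lp 1 \<rho> by (rule weighted_L1)
  obtain w where w: "flow t U = exp (- t) *\<^sub>R U + abs_aefun w" "remainder w"
    using flow_remainder[OF U t] by blast
  note w = w(1) remainderD[OF w(2)]
  obtain z where z: "flow t V = exp (- t) *\<^sub>R V + abs_aefun z" "remainder z"
    using flow_remainder[OF V t] by blast
  note z = z(1) remainderD[OF z(2)]
  let ?D = "abs_aefun (\<lambda>x. w x - z x)"
  have m: "(\<lambda>x. w x - z x) \<in> borel_measurable lebesgue" using w z by measurable
  have b: "\<bar>w x - z x\<bar> \<le> R0" for x using w(3,4)[of x] z(3,4)[of x] by linarith
  have D: "?D \<in> Lp p \<rho>" by (rule bounded_in_Lp[OF m b])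
  have UV: "U - V \<in> Lp p \<rho>" by (rule Lp_diff[OF U V])
  have eq: "flow t U - flow t V = exp (- t) *\<^sub>R (U - V) + ?D"
    unfolding w(1) z(1) minus_abs_aefun[symmetric] by (simp add: scaleR_diff_right)
  have e1: "exp (- t) \<le> 1" using t by simp
  have "?D = (flow t U - flow t V) + - (exp (- t) *\<^sub>R (U - V))" by (simp add: eq)
  then have "Lp_norm 1 \<rho> ?D \<le> Lp_norm 1 \<rho> (flow t U - flow t V) + Lp_norm 1 \<rho> (- (exp (- t) *\<^sub>R (U - V)))"
    using L1.Lp_norm_triangle[OF Lp_subset_L1(1)[OF Lp_diff[OF flow_in_Lp[OF t U] flow_in_Lp[OF t V]]]
        L1.Lp_uminus[OF L1.Lp_scaleR[OF Lp_subset_L1(1)[OF UV]]], of "exp (- t)"] by simp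
  also have "Lp_norm 1 \<rho> (- (exp (- t) *\<^sub>R (U - V))) \<le> 1 * Lp_norm 1 \<rho> (U - V)"
    unfolding L1.Lp_norm_uminus L1.Lp_norm_scaleR
    using e1 by (intro mult_right_mono L1.Lp_norm_nonneg) simp
  also have "Lp_norm 1 \<rho> (flow t U - flow t V) \<le> exp (2 * Lip * t) * Lp_norm 1 \<rho> (U - V)"
    by (rule flow_L1_lipschitz[OF U V t])
  finally have "Lp_norm 1 \<rho> ?D \<le> (exp (2 * Lip * t) + 1) * Lp_norm 1 \<rho> (U - V)"
    by (simp add: algebra_simps)
  also have "\<dots> \<le> (exp (2 * Lip * t) + 1) * (2 * Lp_norm p \<rho> (U - V))"
    by (intro mult_left_mono Lp_subset_L1(2)[OF UV]) (simp add: add_nonneg_nonneg)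
  finally have D1: "Lp_norm 1 \<rho> ?D \<le> 2 * (exp (2 * Lip * t) + 1) * Lp_norm p \<rho> (U - V)"
    by (simp only: mult_ac)
  have "Lp_norm p \<rho> ?D \<le> (R0 powr (p - 1) * Lp_norm 1 \<rho> ?D) powr (1 / p)"
    by (rule Lp_norm_le_L1_norm[OF m b])
  also have "\<dots> \<le> (R0 powr (p - 1) * (2 * (exp (2 * Lip * t) + 1) * Lp_norm p \<rho> (U - V))) powr (1 / p)"
    using D1 p L1.Lp_norm_nonneg by (intro powr_mono2 mult_left_mono mult_nonneg_nonneg) auto
  finally have D2: "Lp_norm p \<rho> ?D \<le> \<dots>" .
  have "Lp_norm p \<rho> (flow t U - flow t V) \<le> exp (- t) * Lp_norm p \<rho> (U - V) + Lp_norm p \<rho> ?D"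
    unfolding eq using Lp_norm_triangle[OF Lp_scaleR[OF UV, of "exp (- t)"] D] by (simp add: Lp_norm_scaleR)
  also have "exp (- t) * Lp_norm p \<rho> (U - V) \<le> 1 * Lp_norm p \<rho> (U - V)"
    by (intro mult_right_mono Lp_norm_nonneg e1)
  finally show ?thesis using D2 by (simp add: Lp_dist_def)
qed

lemma flow_continuous:
  assumes t: "0 \<le> t" and U: "U \<in> Lp p \<rho>" and V: "\<And>n::nat. V n \<in> Lp p \<rho>"
    and lim: "(\<lambda>n. Lp_dist p \<rho> (V n) U) \<longlonglongrightarrow> 0"
  shows "(\<lambda>n. Lp_dist p \<rho> (flow t (V n)) (flow t U)) \<longlonglongrightarrow> 0"
proof (rule tendsto_sandwich[OF _ _ tendsto_const])
  let ?g = "\<lambda>n. R0 powr (p - 1) * (2 * (exp (2 * Lip * t) + 1) * Lp_dist p \<rho> (V n) U)"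
  have "?g \<longlonglongrightarrow> R0 powr (p - 1) * (2 * (exp (2 * Lip * t) + 1) * 0)"
    by (intro tendsto_mult tendsto_const lim)
  then have "(\<lambda>n. ?g n powr (1 / p)) \<longlonglongrightarrow> 0"
    using p by (intro tendsto_zero_powrI[where b = "1 / p"])
      (auto intro!: always_eventually mult_nonneg_nonneg add_nonneg_nonneg simp: nonneg)
  from tendsto_add[OF lim this]
  show "(\<lambda>n. Lp_dist p \<rho> (V n) U + ?g n powr (1 / p)) \<longlonglongrightarrow> 0" by simp
qed (use flow_modulus[OF V U t] in \<open>auto intro!: always_eventually simp: nonneg\<close>)

text \<open>The decaying parts vanish uniformly on the bounded set, so convergence of the orbit
  points reduces to that of the remainders, where pointwise convergence under a common bound
  suffices.\<close>

lemma flow_asymptotically_compact: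
  assumes C: "mbounded C" and c: "\<And>n::nat. c n \<in> C" and \<tau>0: "\<And>n. 0 \<le> \<tau> n"
    and \<tau>: "filterlim \<tau> at_top sequentially"
  shows "\<exists>r Y. strict_mono (r::nat \<Rightarrow> nat) \<and> Y \<in> Lp p \<rho> \<and>
    (\<lambda>n. Lp_dist p \<rho> (flow (\<tau> (r n)) (c (r n))) Y) \<longlonglongrightarrow> 0"
proof -
  obtain B where B: "\<And>U. U \<in> C \<Longrightarrow> Lp_norm p \<rho> U \<le> B" and CL: "C \<subseteq> Lp p \<rho>"
    using C unfolding mbounded_iff_norm by blast
  have cL: "c n \<in> Lp p \<rho>" for n using c CL by blast
  have "\<exists>w. flow (\<tau> n) (c n) = exp (- \<tau> n) *\<^sub>R c n + abs_aefun w \<and> remainder w" for n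
    by (rule flow_remainder[OF cL \<tau>0])
  then obtain w where w: "\<And>n. flow (\<tau> n) (c n) = exp (- \<tau> n) *\<^sub>R c n + abs_aefun (w n)"
    "\<And>n. remainder (w n)"
    by metis
  note w = w(1) remainderD[OF w(2)]
  obtain r l where r: "strict_mono (r::nat \<Rightarrow> nat)" and l: "\<And>x. (\<lambda>n. w (r n) x) \<longlonglongrightarrow> l x"
    by (rule equi_Lipschitz_subsequence[of w R0 \<Lambda>]) (use w in auto)
  have lm: "l \<in> borel_measurable lebesgue"
    by (rule borel_measurable_LIMSEQ_real[of _ "\<lambda>n. w (r n)"]) (use l w in auto)
  have lb: "0 \<le> l x" "l x \<le> R0" for x
    using LIMSEQ_le_const[OF l] LIMSEQ_le_const2[OF l] w by blast+
  have Y: "abs_aefun l \<in> Lp p \<rho>" using lb by (intro bounded_in_Lp[OF lm, of R0]) auto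
  have m: "(\<lambda>x. w (r n) x - l x) \<in> borel_measurable lebesgue" for n using w lm by measurable
  have b: "\<bar>w (r n) x - l x\<bar> \<le> R0" for n x using w(3,4)[of "r n" x] lb[of x] by linarith
  have lim1: "(\<lambda>n. Lp_norm p \<rho> (abs_aefun (\<lambda>x. w (r n) x - l x))) \<longlonglongrightarrow> 0"
    using l by (intro Lp_norm_bounded_convergence[of _ R0] m b) (simp add: LIM_zero)
  have "(\<lambda>n. exp (- \<tau> (r n))) \<longlonglongrightarrow> 0"
    by (rule filterlim_compose[OF exp_at_bot filterlim_compose[OF filterlim_uminus_at_bot_at_top
          filterlim_compose[OF \<tau> filterlim_subseq[OF r]]]])
  then have lim2: "(\<lambda>n. exp (- \<tau> (r n)) * B) \<longlonglongrightarrow> 0 * B" by (intro tendsto_mult tendsto_const)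
  have le: "Lp_dist p \<rho> (flow (\<tau> (r n)) (c (r n))) (abs_aefun l) \<le>
      exp (- \<tau> (r n)) * B + Lp_norm p \<rho> (abs_aefun (\<lambda>x. w (r n) x - l x))" for n
  proof -
    have "flow (\<tau> (r n)) (c (r n)) - abs_aefun l =
        exp (- \<tau> (r n)) *\<^sub>R c (r n) + abs_aefun (\<lambda>x. w (r n) x - l x)"
      unfolding w(1) minus_abs_aefun[symmetric] by simp
    then have "Lp_dist p \<rho> (flow (\<tau> (r n)) (c (r n))) (abs_aefun l) \<le>
        exp (- \<tau> (r n)) * Lp_norm p \<rho> (c (r n)) + Lp_norm p \<rho> (abs_aefun (\<lambda>x. w (r n) x - l x))"
      using Lp_norm_triangle[OF Lp_scaleR[OF cL] bounded_in_Lp[OF m b], of "exp (- \<tau> (r n))" "r n" n]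
      by (simp add: Lp_dist_def Lp_norm_scaleR)
    also have "exp (- \<tau> (r n)) * Lp_norm p \<rho> (c (r n)) \<le> exp (- \<tau> (r n)) * B"
      using B[OF c] by (intro mult_left_mono) auto
    finally show ?thesis by simp
  qed
  have "(\<lambda>n. Lp_dist p \<rho> (flow (\<tau> (r n)) (c (r n))) (abs_aefun l)) \<longlonglongrightarrow> 0"
  proof (rule tendsto_sandwich[OF _ _ tendsto_const])
    show "(\<lambda>n. exp (- \<tau> (r n)) * B + Lp_norm p \<rho> (abs_aefun (\<lambda>x. w (r n) x - l x))) \<longlonglongrightarrow> 0"
      using tendsto_add[OF lim2 lim1] by simp
  qed (use le in \<open>auto intro!: always_eventually simp: nonneg\<close>)
  with r Y show ?thesis by blast
qed

lemma flow_absorbing: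
  assumes C: "mbounded C" and R: "R0 < R"
  shows "\<exists>T\<ge>0. \<forall>t\<ge>T. flow t ` C \<subseteq> {U \<in> Lp p \<rho>. Lp_norm p \<rho> U \<le> R}"
proof -
  obtain B where B: "\<And>U. U \<in> C \<Longrightarrow> Lp_norm p \<rho> U \<le> B" and CL: "C \<subseteq> Lp p \<rho>"
    using C unfolding mbounded_iff_norm by blast
  have "((\<lambda>t. exp (- t) * B) \<longlongrightarrow> 0 * B) at_top"
    by (intro tendsto_mult tendsto_const filterlim_compose[OF exp_at_bot filterlim_uminus_at_bot_at_top])
  then have "eventually (\<lambda>t. exp (- t) * B < R - R0) at_top"
    using R by (intro order_tendstoD) auto
  then obtain T where T: "\<And>t. t \<ge> T \<Longrightarrow> exp (- t) * B < R - R0"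
    by (auto simp: eventually_at_top_linorder)
  have "Lp_norm p \<rho> (flow t U) \<le> R" if "t \<ge> max 0 T" "U \<in> C" for t U
  proof -
    have "exp (- t) * Lp_norm p \<rho> U \<le> exp (- t) * B" using B that by (intro mult_left_mono) auto
    moreover have "U \<in> Lp p \<rho>" "0 \<le> t" "T \<le> t" using that CL by auto
    ultimately show ?thesis using flow_norm_le[of U t] T[of t] by linarith
  qed
  then show ?thesis
    using CL flow_in_Lp by (intro exI[of _ "max 0 T"]) auto
qed

lemma flow_dissipative:
  assumes "R0 < R"
  shows "dissipative_semigroup (Lp p \<rho>) (Lp_dist p \<rho>) flow {U \<in> Lp p \<rho>. Lp_norm p \<rho> U \<le> R}"
proof unfold_locales
  show "mbounded {U \<in> Lp p \<rho>. Lp_norm p \<rho> U \<le> R}" by (auto simp: mbounded_iff_norm)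
qed (use flow_in_Lp flow_add flow_continuous flow_asymptotically_compact flow_absorbing[OF _ assms] in blast)+

text \<open>Orbit points from the ball at time \<open>t\<close> have norm at most
  \<open>exp (- t) * R + R0\<close>. Since omega-limit points are approached at arbitrarily late
  times, the radius \<open>R\<close> drops out of the bound.\<close>

lemma omega_norm_le:
  assumes R: "R0 < R"
    and Y: "Y \<in> omega_limit mtopology flow {U \<in> Lp p \<rho>. Lp_norm p \<rho> U \<le> R}"
  shows "Lp_norm p \<rho> Y \<le> R0"
proof -
  interpret D: dissipative_semigroup "Lp p \<rho>" "Lp_dist p \<rho>" flow "{U \<in> Lp p \<rho>. Lp_norm p \<rho> U \<le> R}"
    by (rule flow_dissipative[OF R])
  have YL: "Y \<in> Lp p \<rho>" using D.omega_subset Y by blast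
  show ?thesis
  proof (rule field_le_epsilon)
    fix e :: real assume e: "0 < e"
    have "((\<lambda>t. exp (- t) * R) \<longlongrightarrow> 0 * R) at_top"
      by (intro tendsto_mult tendsto_const filterlim_compose[OF exp_at_bot filterlim_uminus_at_bot_at_top])
    then have "eventually (\<lambda>t. exp (- t) * R < e / 2) at_top"
      using e by (intro order_tendstoD) auto
    then obtain s where s: "\<And>t. t \<ge> s \<Longrightarrow> exp (- t) * R < e / 2"
      by (auto simp: eventually_at_top_linorder)
    have "0 \<le> max 0 s" "0 < e / 2" using e by auto
    then obtain t b where t: "max 0 s \<le> t" and b: "b \<in> {U \<in> Lp p \<rho>. Lp_norm p \<rho> U \<le> R}"
      and d: "Lp_dist p \<rho> (flow t b) Y < e / 2"
      using Y unfolding D.mem_omega_iff by blast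
    have t0: "0 \<le> t" "s \<le> t" using t by auto
    have bL: "b \<in> Lp p \<rho>" "Lp_norm p \<rho> b \<le> R" using b by auto
    have "Lp_norm p \<rho> Y \<le> Lp_norm p \<rho> (Y - flow t b) + Lp_norm p \<rho> (flow t b)"
      using Lp_norm_triangle[OF Lp_diff[OF YL flow_in_Lp[OF t0(1) bL(1)]] flow_in_Lp[OF t0(1) bL(1)]]
      by simp
    also have "Lp_norm p \<rho> (Y - flow t b) = Lp_dist p \<rho> (flow t b) Y"
      using commute[of Y "flow t b"] by (simp add: Lp_dist_def)
    also have "Lp_norm p \<rho> (flow t b) \<le> exp (- t) * Lp_norm p \<rho> b + R0"
      by (rule flow_norm_le[OF bL(1) t0(1)])
    also have "exp (- t) * Lp_norm p \<rho> b \<le> exp (- t) * R"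
      using bL by (intro mult_left_mono) auto
    finally show "Lp_norm p \<rho> Y \<le> R0 + e" using d s[OF t0(2)] by linarith
  qed
qed

end

text \<open>Expanding a direction along the coordinate axes bounds the operator norm of the
  derivative by the sum of the bounds on the partials; the mean value inequality does the
  rest.\<close>

lemma C1_bounded_partials_lipschitz:
  fixes J :: "real^'n::finite \<Rightarrow> real"
  assumes J: "C1_fun J" and bounded: "\<And>i. bounded (range (partial i J))"
  shows "\<exists>M. \<forall>x y. \<bar>J x - J y\<bar> \<le> M * norm (x - y)"
proof -
  obtain m where m: "\<And>i x. \<bar>partial i J x\<bar> \<le> m i"
    using bounded unfolding bounded_iff by (metis rangeI real_norm_def)
  let ?D = "\<lambda>x. frechet_derivative J (at x)"
  have der: "(J has_derivative ?D x) (at x)" for x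
    using J frechet_derivative_works by (auto simp: C1_fun_def)
  have "onorm (?D x) \<le> (\<Sum>i\<in>UNIV. m i)" for x
  proof (rule onorm_le)
    fix v :: "real^'n"
    have lin: "linear (?D x)" by (rule has_derivative_linear[OF der])
    have "?D x v = ?D x (\<Sum>i\<in>UNIV. v $ i *\<^sub>R axis i 1)"
      using basis_expansion[of v] by (simp add: scalar_mult_eq_scaleR)
    also have "\<dots> = (\<Sum>i\<in>UNIV. v $ i * partial i J x)"
      by (simp add: linear_sum[OF lin] linear_cmul[OF lin] partial_def)
    also have "\<bar>\<dots>\<bar> \<le> (\<Sum>i\<in>UNIV. norm v * m i)"
      by (rule order_trans[OF sum_abs sum_mono])
        (auto simp: abs_mult intro!: mult_mono m component_le_norm_cart)
    finally show "norm (?D x v) \<le> (\<Sum>i\<in>UNIV. m i) * norm v"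
      by (simp add: mult.commute flip: sum_distrib_left)
  qed
  then have "norm (J x - J y) \<le> (\<Sum>i\<in>UNIV. m i) * norm (x - y)" for x y
    by (intro differentiable_bound[of UNIV]) (auto intro: der)
  then show ?thesis by (intro exI[of _ "\<Sum>i\<in>UNIV. m i"]) simp
qed

theorem theorem3p3:
  fixes p h Sb k1 a K R \<epsilon> :: real
    and J \<rho> :: "real^'n::finite \<Rightarrow> real"
    and f :: "real \<Rightarrow> real"
    and S :: "real \<Rightarrow> (real^'n) aefun \<Rightarrow> (real^'n) aefun"
    and \<A> :: "(real^'n) aefun set"
  assumes p: "1 < p" and h: "0 < h"
    and J_C1: "C1_fun J"
    and J_nonneg: "\<And>x. 0 \<le> J x"
    and J_even: "\<And>x. J (- x) = J x"
    and J_supp: "closure {x. J x \<noteq> 0} \<subseteq> cball 0 1"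
    and J_partial_bounded: "\<And>i. bounded (range (partial i J))"
    and Sb: "0 < Sb"
    and J_partial_int1:
      "\<And>i. (SUP x. \<integral>\<^sup>+ y. ennreal \<bar>partial i J (x - y)\<bar> \<partial>lebesgue) \<le> ennreal Sb"
    and J_partial_int2:
      "\<And>i. (SUP y. \<integral>\<^sup>+ x. ennreal \<bar>partial i J (x - y)\<bar> \<partial>lebesgue) \<le> ennreal Sb"
    and f_nonneg: "\<And>x. 0 \<le> f x"
    and f_mono: "mono f"
    and k1: "0 < k1"
    and f_lipschitz: "\<And>x y. \<bar>f x - f y\<bar> \<le> k1 * \<bar>x - y\<bar>"
    and a: "0 < a"
    and f_bounded: "\<And>x. \<bar>f x\<bar> \<le> a"
    and \<rho>_integrable: "integrable lebesgue \<rho>"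
    and \<rho>_pos: "\<And>x. 0 < \<rho> x"
    and \<rho>_even: "\<And>x. \<rho> (- x) = \<rho> x"
    and \<rho>_int: "(\<integral>x. \<rho> x \<partial>lebesgue) = 1"
    and K: "0 < K"
    and \<rho>_K: "\<And>y. (SUP x\<in>{x. norm (x - y) \<le> 1}. ereal (\<rho> x)) \<le> ereal (K * \<rho> y)"
    and R_def: "R = a * K powr (1 / p) * (\<integral>x. \<bar>J x\<bar> \<partial>lebesgue) + h"
    and \<epsilon>: "0 < \<epsilon>"
    and S_def: "S = Lp_flow p \<rho> (neural_rhs J f h)"
    and \<A>_def: "\<A> = omega_limit (Metric_space.mtopology (Lp p \<rho>) (Lp_dist p \<rho>)) S
                   {u \<in> Lp p \<rho>. Lp_norm p \<rho> u \<le> R + \<epsilon>}"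
  shows "global_attractor (Lp p \<rho>) (Lp_dist p \<rho>) S \<A> \<and>
         \<A> \<subseteq> {u \<in> Lp p \<rho>. Lp_norm p \<rho> u \<le> R}"
proof -
  obtain M where M: "\<And>x y. \<bar>J x - J y\<bar> \<le> M * norm (x - y)"
    using C1_bounded_partials_lipschitz[OF J_C1 J_partial_bounded] by blast
  interpret neural_field p \<rho> J f h a k1 K M
  proof unfold_locales
    show "J x = 0" if "1 < norm x" for x
      using that J_supp closure_subset[of "{x. J x \<noteq> 0}"] by (auto simp: not_le)
    show "\<rho> x \<le> K * \<rho> y" if "norm (x - y) \<le> 1" for x y
    proof -
      have "ereal (\<rho> x) \<le> (SUP x\<in>{x. norm (x - y) \<le> 1}. ereal (\<rho> x))"
        using that by (intro SUP_upper) simp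
      also note \<rho>_K
      finally show ?thesis by simp
    qed
    show "f x \<le> a" for x using f_bounded[of x] by simp
  qed (use assms M in auto)
  \<comment> \<open>The constant \<open>R\<close> exceeds the intrinsic bound \<open>R0\<close> only
    through the factor \<open>K powr (1 / p)\<close>, which is at least 1.\<close>
  have "a * 1 * mass \<le> a * K powr (1 / p) * mass"
    using K_ge_1 p a mass_nonneg by (intro mult_right_mono mult_left_mono ge_one_powr_ge_zero) auto
  then have R0_le: "R0 \<le> R" by (simp add: R0_def R_def mass_def J_nonneg)
  then have R0_less: "R0 < R + \<epsilon>" using \<epsilon> by simp
  interpret D: dissipative_semigroup "Lp p \<rho>" "Lp_dist p \<rho>" flow "{U \<in> Lp p \<rho>. Lp_norm p \<rho> U \<le> R + \<epsilon>}"
    by (rule flow_dissipative[OF R0_less])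
  show ?thesis
    unfolding \<A>_def S_def
    using D.omega_global_attractor D.omega_subset omega_norm_le[OF R0_less] R0_le by force
qed

end
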